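(* For constrained persuasion with unique accepts, for every fixed $\varepsilon\in(0,1]$, the algorithm $\mathcal{P}_\varepsilon$ described in the context runs in time $m^{O(1/\varepsilon)}n^{O(1)}$ on instances with $n$ states and $m$ signals, and outputs a $(1+\varepsilon)$-approximate solution.
   Context: Constrained persuasion. An instance consists of a finite set $\Theta$ of $n$ states partitioned as $\Theta=\Theta_A\sqcup\Theta_R$ (acceptable and rejectable states), a finite set $\Sigma$ of $m$ signals, rational probabilities $q_\theta>0$ with $\sum_\theta q_\theta=1$, and a bipartite graph $H=(\Theta\cup\Sigma,E)$, $E\subseteq\Theta\times\Sigma$, without isolated vertices; $(\theta,\sigma)\in E$ means that $\sigma$ may be sent in state $\theta$, and $N(\cdot)$ denotes neighborhoods. The sender commits to a signaling scheme $\varphi:E\to[0,1]$ with $\sum_{\sigma\in N(\theta)}\varphi(\theta,\sigma)=q_\theta$ for all $\theta\in\Theta$. The receiver accepts on signal $\sigma$ if and only if $\sum_{\theta\in N(\sigma)\cap\Theta_A}\varphi(\theta,\sigma)\ge\sum_{\theta\in N(\sigma)\cap\Theta_R}\varphi(\theta,\sigma)$ (ties broken in favor of accepting); then $\sigma$ is an accept signal, otherwise a reject signal. The sender's utility is $\sum_{\sigma\text{ accept signal}}\sum_{\theta\in N(\sigma)}\varphi(\theta,\sigma)$. The goal is to find $\varphi$ maximizing it; let $\mathrm{OPT}$ be the maximum. A $\rho$-approximate solution is a signaling scheme with sender utility at least $\mathrm{OPT}/\rho$. Unique accepts: $|\Theta_A|=1$; write $\Theta_A=\{\theta_a\}$.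 Notation: for $T\subseteq\Sigma$, $N(T)=\bigcup_{\sigma\in T}N(\sigma)$ and $\Theta_R(T)=\{\theta\in\Theta_R : N(\theta)\subseteq T\}$; $\Theta_R(\sigma)=\Theta_R(\{\sigma\})$. Algorithm $\mathcal{P}_\varepsilon$. Input: an instance with single acceptable state $\theta_a$, and $\varepsilon>0$. Output: a signaling scheme $\varphi_{\mathrm{ALG}}$. 1. Set $\Sigma_{\ge\varepsilon}=\{\sigma\in\Sigma : \sum_{\theta\in\Theta_R(\sigma)}q_\theta\ge\varepsilon q_{\theta_a}\}$ and $\Sigma_{<\varepsilon}=\Sigma\setminus\Sigma_{\ge\varepsilon}$. 2. Initialize $\varphi_{\mathrm{ALG}}$ as an arbitrary signaling scheme. 3. For every (possibly empty) subset $S\subseteq\Sigma_{\ge\varepsilon}$ of size at most $1/\varepsilon$: let $T=S$, and while $\sum_{\theta\in\Theta_R(T)}q_\theta\le q_{\theta_a}$ do: (a) If the utility of $\varphi_{\mathrm{ALG}}$ is less than $\min\{2q_{\theta_a},\sum_{\theta\in N(T)}q_\theta\}$, let $\varphi_{\mathrm{ALG}}$ be the optimal (for the sender) signaling scheme consistent with the signal partition in which $T$ is the set of accept signals and $\Sigma\setminus T$ the set of reject signals. (b) If $T=\Sigma_{<\varepsilon}\cap N(\theta_a)$, break from the while loop. Otherwise, add an arbitrary signal from $(\Sigma_{<\varepsilon}\cap N(\theta_a))\setminus T$ to $T$. The optimal scheme in (a) is computed in polynomial time by the following greedy procedure (for nonempty $T\subseteq N(\theta_a)$ with $\sum_{\theta\in\Theta_R(T)}q_\theta\le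 q_{\theta_a}$; it yields sender utility $\min\{2q_{\theta_a},\sum_{\theta\in N(T)}q_\theta\}$): assign the mass of states in $\Theta_R(T)$ arbitrarily; assign mass of the other states in $N(T)\cap\Theta_R$ so that the total mass of rejectable states on signals of $T$ is $\min\{q_{\theta_a},\sum_{\theta\in N(T)\cap\Theta_R}q_\theta\}$; assign the mass of $\theta_a$ only to signals of $T$ so that on each $\sigma\in T$ it is at least the mass of rejectable states on $\sigma$; make all remaining assignments arbitrarily so as to obtain a feasible signaling scheme.
   Formalization: The while loop breaks once no signal of Σ_{<ε}∩N(θ_a) is left to add (T equal to that set never holds for S≠∅); step (a) keeps the current scheme if T is not contained in N(θ_a); signals outside T may be unused instead of rejected; time is counted with unit-cost arithmetic. *)

theory Defs
  imports Complex_Main "HOL-Library.Multiset" "HOL-Library.Monad_Syntax"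
begin

section \<open>Constrained persuasion\<close>

record ('s, 'g) persuasion =
  acceptable :: "'s set"
  rejectable :: "'s set"
  signals :: "'g set"
  prior :: "'s \<Rightarrow> real"
  edges :: "('s \<times> 'g) set"

definition states :: "('s, 'g) persuasion \<Rightarrow> 's set" where
  "states I = acceptable I \<union> rejectable I"

definition persuasion_instance :: "('s, 'g) persuasion \<Rightarrow> bool" where
  "persuasion_instance I \<longleftrightarrow>
     finite (states I) \<and> finite (signals I) \<and> acceptable I \<inter> rejectable I = {} \<and>
     (\<forall>\<theta>\<in>states I. prior I \<theta> \<in> \<rat> \<and> prior I \<theta> > 0) \<and> (\<Sum>\<theta>\<in>states I. prior I \<theta>) = 1 \<and>
     edges I \<subseteq> states I \<times> signals I \<and>
     (\<forall>\<theta>\<in>states I. \<exists>\<sigma>. (\<theta>, \<sigma>) \<in> edges I) \<and> (\<forall>\<sigma>\<in>signals I. \<exists>\<theta>. (\<theta>, \<sigma>) \<in> edges I)"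

definition state_nbrs :: "('s, 'g) persuasion \<Rightarrow> 's \<Rightarrow> 'g set" where
  "state_nbrs I \<theta> = {\<sigma>. (\<theta>, \<sigma>) \<in> edges I}"

definition signal_nbrs :: "('s, 'g) persuasion \<Rightarrow> 'g \<Rightarrow> 's set" where
  "signal_nbrs I \<sigma> = {\<theta>. (\<theta>, \<sigma>) \<in> edges I}"

definition set_nbrs :: "('s, 'g) persuasion \<Rightarrow> 'g set \<Rightarrow> 's set" where
  "set_nbrs I T = (\<Union>\<sigma>\<in>T. signal_nbrs I \<sigma>)"

text \<open>A scheme is a function on all pairs; only its values on the edges are relevant.\<close>

type_synonym ('s, 'g) scheme = "'s \<times> 'g \<Rightarrow> real"

definition signaling_scheme :: "('s, 'g) persuasion \<Rightarrow> ('s, 'g) scheme \<Rightarrow> bool" where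
  "signaling_scheme I \<phi> \<longleftrightarrow>
     (\<forall>e\<in>edges I. 0 \<le> \<phi> e \<and> \<phi> e \<le> 1) \<and>
     (\<forall>\<theta>\<in>states I. (\<Sum>\<sigma>\<in>state_nbrs I \<theta>. \<phi> (\<theta>, \<sigma>)) = prior I \<theta>)"

definition accept_signal :: "('s, 'g) persuasion \<Rightarrow> ('s, 'g) scheme \<Rightarrow> 'g \<Rightarrow> bool" where
  "accept_signal I \<phi> \<sigma> \<longleftrightarrow>
     (\<Sum>\<theta>\<in>signal_nbrs I \<sigma> \<inter> acceptable I. \<phi> (\<theta>, \<sigma>)) \<ge> (\<Sum>\<theta>\<in>signal_nbrs I \<sigma> \<inter> rejectable I. \<phi> (\<theta>, \<sigma>))"

definition utility :: "('s, 'g) persuasion \<Rightarrow> ('s, 'g) scheme \<Rightarrow> real" where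
  "utility I \<phi> = (\<Sum>\<sigma>\<in>{\<sigma>\<in>signals I. accept_signal I \<phi> \<sigma>}. \<Sum>\<theta>\<in>signal_nbrs I \<sigma>. \<phi> (\<theta>, \<sigma>))"

text \<open>The utilities of schemes form a nonempty subset of \<open>[0, 1]\<close>, so their maximum is this supremum.\<close>

definition opt :: "('s, 'g) persuasion \<Rightarrow> real" where
  "opt I = Sup (utility I ` {\<phi>. signaling_scheme I \<phi>})"

definition approx_solution :: "('s, 'g) persuasion \<Rightarrow> real \<Rightarrow> ('s, 'g) scheme \<Rightarrow> bool" where
  "approx_solution I \<rho> \<phi> \<longleftrightarrow> signaling_scheme I \<phi> \<and> utility I \<phi> \<ge> opt I / \<rho>"

text \<open>Ties are broken in favor of accepting, so a signal that is never sent is formally an accept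
  signal. It does not affect the utility, and a scheme may leave signals outside \<open>T\<close> unused and
  still be consistent with \<open>T\<close> being the set of accept signals.\<close>

definition consistent_scheme :: "('s, 'g) persuasion \<Rightarrow> 'g set \<Rightarrow> ('s, 'g) scheme \<Rightarrow> bool" where
  "consistent_scheme I T \<phi> \<longleftrightarrow> signaling_scheme I \<phi> \<and>
     (\<forall>\<sigma>\<in>T. accept_signal I \<phi> \<sigma>) \<and>
     (\<forall>\<sigma>\<in>signals I - T. \<not> accept_signal I \<phi> \<sigma> \<or> (\<forall>\<theta>\<in>signal_nbrs I \<sigma>. \<phi> (\<theta>, \<sigma>) = 0))"

definition optimal_consistent_scheme ::
    "('s, 'g) persuasion \<Rightarrow> 'g set \<Rightarrow> ('s, 'g) scheme \<Rightarrow> bool" where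
  "optimal_consistent_scheme I T \<phi> \<longleftrightarrow> consistent_scheme I T \<phi> \<and>
     (\<forall>\<psi>. consistent_scheme I T \<psi> \<longrightarrow> utility I \<psi> \<le> utility I \<phi>)"

definition theta_a :: "('s, 'g) persuasion \<Rightarrow> 's" where
  "theta_a I = the_elem (acceptable I)"

definition captive :: "('s, 'g) persuasion \<Rightarrow> 'g set \<Rightarrow> 's set" where \<comment> \<open>\<open>\<Theta>\<^sub>R(T)\<close>\<close>
  "captive I T = {\<theta>\<in>rejectable I. state_nbrs I \<theta> \<subseteq> T}"

definition heavy :: "('s, 'g) persuasion \<Rightarrow> real \<Rightarrow> 'g set" where \<comment> \<open>\<open>\<Sigma>\<^bsub>\<ge>\<epsilon>\<^esub>\<close>\<close>
  "heavy I \<epsilon> = {\<sigma>\<in>signals I. (\<Sum>\<theta>\<in>captive I {\<sigma>}. prior I \<theta>) \<ge> \<epsilon> * prior I (theta_a I)}"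


section \<open>Nondeterministic programs with running time\<close>

text \<open>
  A program is run with a time budget and yields the set of its possible outcomes:
  \<open>Some (x, b)\<close> is a run that returns \<open>x\<close> with \<open>b\<close> time units left, \<open>None\<close> is a run that
  exceeds the budget (in particular, one that diverges) or gets stuck. Nondeterminism models
  the arbitrary choices of the algorithm; all of them are quantified universally in
  \<open>runs_within\<close> below.

  The cost measure is that of a random access machine with unit-cost arithmetic and comparison of
  numbers, unit-cost access to the prior, and an adjacency matrix for the edges. One unit is charged
  for each \<open>eval\<close> (which evaluates an expression built from a bounded number of elementary
  operations), each arbitrary choice, and each iteration of a loop. Schemes are arrays indexed by
  pairs, so \<open>f(x := y)\<close> is an array write. Sets of states or signals are stored both as lists and
  as bit arrays, so that membership tests, insertions and emptiness tests are elementary, as is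
  every step of an iteration over such a set. Updated arrays and sets are never used again, so
  the updates can be done in place.
\<close>

type_synonym 'a prog = "nat \<Rightarrow> ('a \<times> nat) option set"

definition ret :: "'a \<Rightarrow> 'a prog" where
  "ret x = (\<lambda>b. {Some (x, b)})"

definition fail :: "'a prog" where
  "fail = (\<lambda>b. {None})"

definition prog_bind :: "'a prog \<Rightarrow> ('a \<Rightarrow> 'b prog) \<Rightarrow> 'b prog" where
  "prog_bind p f = (\<lambda>b. \<Union>r\<in>p b. case r of None \<Rightarrow> {None} | Some (x, b') \<Rightarrow> f x b')"

adhoc_overloading Monad_Syntax.bind \<rightleftharpoons> prog_bind

definition tick :: "unit prog" where
  "tick = (\<lambda>b. if b = 0 then {None} else {Some ((), b - 1)})"

definition eval :: "'a \<Rightarrow> 'a prog" where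
  "eval x = do { tick; ret x }"

definition pick :: "'a set \<Rightarrow> 'a prog" where
  "pick X = (\<lambda>b. if b = 0 \<or> X = {} then {None} else (\<lambda>x. Some (x, b - 1)) ` X)"

primrec visit :: "'x list \<Rightarrow> ('x \<Rightarrow> 'a \<Rightarrow> 'a prog) \<Rightarrow> 'a \<Rightarrow> 'a prog" where
  "visit [] f a = ret a"
| "visit (x # xs) f a = do { tick; a' \<leftarrow> f x a; visit xs f a' }"

text \<open>Both loops visit the elements in an arbitrary order.\<close>

definition foreach :: "'x set \<Rightarrow> ('x \<Rightarrow> 'a \<Rightarrow> 'a prog) \<Rightarrow> 'a \<Rightarrow> 'a prog" where
  "foreach X f a =
     (\<lambda>b. if finite X then \<Union>xs\<in>{xs. distinct xs \<and> set xs = X}. visit xs f a b else {None})"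

definition foreach_list :: "'x list \<Rightarrow> ('x \<Rightarrow> 'a \<Rightarrow> 'a prog) \<Rightarrow> 'a \<Rightarrow> 'a prog" where
  "foreach_list xs f a = (\<lambda>b. \<Union>ys\<in>{ys. mset ys = mset xs}. visit ys f a b)"

primrec while_fuel :: "nat \<Rightarrow> ('a \<Rightarrow> bool prog) \<Rightarrow> ('a \<Rightarrow> 'a prog) \<Rightarrow> 'a \<Rightarrow> 'a prog" where
  "while_fuel 0 c f a = fail"
| "while_fuel (Suc k) c f a =
     do { tick; t \<leftarrow> c a; if t then do { a' \<leftarrow> f a; while_fuel k c f a' } else ret a }"

text \<open>Every iteration costs at least one unit, so this fuel does not run out before the budget
  does.\<close>

definition while_loop :: "('a \<Rightarrow> bool prog) \<Rightarrow> ('a \<Rightarrow> 'a prog) \<Rightarrow> 'a \<Rightarrow> 'a prog" where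
  "while_loop c f a = (\<lambda>b. while_fuel (Suc b) c f a b)"

text \<open>\<open>p ensuring Q\<close> is the program \<open>p\<close> with the claim that its result satisfies \<open>Q\<close>. The claim is
  not executed; a run violating it counts as stuck.\<close>

definition ensuring :: "'a prog \<Rightarrow> ('a \<Rightarrow> bool) \<Rightarrow> 'a prog" (infixl \<open>ensuring\<close> 55) where
  "p ensuring Q = do { x \<leftarrow> p; if Q x then ret x else fail }"

definition runs_within :: "'a prog \<Rightarrow> nat \<Rightarrow> ('a \<Rightarrow> bool) \<Rightarrow> bool" where
  "runs_within p t Q \<longleftrightarrow> p t \<noteq> {} \<and> (\<forall>r\<in>p t. \<exists>x b. r = Some (x, b) \<and> Q x)"

definition filter_prog :: "'x set \<Rightarrow> ('x \<Rightarrow> bool prog) \<Rightarrow> 'x set prog" where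
  "filter_prog X P =
     foreach X (\<lambda>x Y. do { t \<leftarrow> P x; eval (if t then insert x Y else Y) }) {}"


section \<open>The algorithm\<close>

subsection \<open>Neighborhoods and masses\<close>

definition within_prog :: "('s, 'g) persuasion \<Rightarrow> 'g set \<Rightarrow> 's \<Rightarrow> bool prog" where
  "within_prog I T \<theta> =
     foreach (signals I) (\<lambda>\<sigma> t. eval (t \<and> ((\<theta>, \<sigma>) \<in> edges I \<longrightarrow> \<sigma> \<in> T))) True
     ensuring (\<lambda>t. t \<longleftrightarrow> state_nbrs I \<theta> \<subseteq> T)"

definition touches_prog :: "('s, 'g) persuasion \<Rightarrow> 'g set \<Rightarrow> 's \<Rightarrow> bool prog" where
  "touches_prog I T \<theta> =
     foreach (signals I) (\<lambda>\<sigma> t. eval (t \<or> ((\<theta>, \<sigma>) \<in> edges I \<and> \<sigma> \<in> T))) False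
     ensuring (\<lambda>t. t \<longleftrightarrow> \<theta> \<in> set_nbrs I T)"

definition prior_sum_prog :: "('s, 'g) persuasion \<Rightarrow> 's set \<Rightarrow> real prog" where
  "prior_sum_prog I A = foreach A (\<lambda>\<theta> s. eval (s + prior I \<theta>)) 0"

definition captive_mass_prog :: "('s, 'g) persuasion \<Rightarrow> 'g set \<Rightarrow> real prog" where
  "captive_mass_prog I T =
     do { A \<leftarrow> filter_prog (rejectable I) (within_prog I T); prior_sum_prog I A }
     ensuring (\<lambda>s. s = (\<Sum>\<theta>\<in>captive I T. prior I \<theta>))"

definition nbrs_mass_prog :: "('s, 'g) persuasion \<Rightarrow> 'g set \<Rightarrow> real prog" where
  "nbrs_mass_prog I T =
     do { A \<leftarrow> filter_prog (states I) (touches_prog I T); prior_sum_prog I A }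
     ensuring (\<lambda>s. s = (\<Sum>\<theta>\<in>set_nbrs I T. prior I \<theta>))"

definition load_prog ::
    "('s, 'g) persuasion \<Rightarrow> 's set \<Rightarrow> 'g \<Rightarrow> ('s, 'g) scheme \<Rightarrow> real prog" where
  "load_prog I A \<sigma> \<phi> =
     foreach A (\<lambda>\<theta> s. eval (if (\<theta>, \<sigma>) \<in> edges I then s + \<phi> (\<theta>, \<sigma>) else s)) 0"

definition utility_prog :: "('s, 'g) persuasion \<Rightarrow> ('s, 'g) scheme \<Rightarrow> real prog" where
  "utility_prog I \<phi> =
     foreach (signals I) (\<lambda>\<sigma> u. do {
         a \<leftarrow> load_prog I (acceptable I) \<sigma> \<phi>;
         r \<leftarrow> load_prog I (rejectable I) \<sigma> \<phi>;
         eval (if a \<ge> r then u + (a + r) else u)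
       }) 0
     ensuring (\<lambda>u. u = utility I \<phi>)"

subsection \<open>Constructing schemes\<close>

definition zero_prog :: "('s, 'g) persuasion \<Rightarrow> ('s, 'g) scheme prog" where
  "zero_prog I =
     foreach (states I) (\<lambda>\<theta> \<phi>. foreach (signals I) (\<lambda>\<sigma> \<phi>. eval (\<phi>((\<theta>, \<sigma>) := 0))) \<phi>) undefined"

text \<open>Distributes the additional mass \<open>x\<close> of state \<open>\<theta>\<close> arbitrarily over the signals in \<open>X\<close>: every
  signal receives an arbitrary part of what is left, and the final rest goes to an arbitrary
  signal.\<close>

definition split_prog ::
    "'s \<Rightarrow> 'g set \<Rightarrow> real \<Rightarrow> ('s, 'g) scheme \<Rightarrow> ('s, 'g) scheme prog" where
  "split_prog \<theta> X x \<phi> = do {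
     (\<phi>, r) \<leftarrow> foreach X (\<lambda>\<sigma> (\<phi>, r). do {
         y \<leftarrow> pick {0..r};
         eval (\<phi>((\<theta>, \<sigma>) := \<phi> (\<theta>, \<sigma>) + y), r - y)
       }) (\<phi>, x);
     if r = 0 then ret \<phi>
     else do { \<sigma> \<leftarrow> pick X; eval (\<phi>((\<theta>, \<sigma>) := \<phi> (\<theta>, \<sigma>) + r)) }
   }"

definition spread_prog ::
    "('s, 'g) persuasion \<Rightarrow> 's \<Rightarrow> ('s, 'g) scheme \<Rightarrow> ('s, 'g) scheme prog" where
  "spread_prog I \<theta> \<phi> = do {
     X \<leftarrow> filter_prog (signals I) (\<lambda>\<sigma>. eval ((\<theta>, \<sigma>) \<in> edges I));
     split_prog \<theta> X (prior I \<theta>) \<phi>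
   }"

definition arbitrary_scheme_prog :: "('s, 'g) persuasion \<Rightarrow> ('s, 'g) scheme prog" where
  "arbitrary_scheme_prog I =
     do { \<phi> \<leftarrow> zero_prog I; foreach (states I) (spread_prog I) \<phi> }
     ensuring signaling_scheme I"

text \<open>The greedy procedure for the optimal scheme with set of accept signals \<open>T\<close>. In the second loop,
  \<open>need\<close> is the mass of rejectable states that is still to be put on \<open>T\<close>, and \<open>rest\<close> is the total
  mass of the states of \<open>B\<close> not yet treated. The state \<open>\<theta>\<close> puts an arbitrary amount \<open>x\<close> on \<open>T\<close>,
  subject only to the requirement that \<open>need\<close> can be met exactly.\<close>

definition greedy_prog :: "('s, 'g) persuasion \<Rightarrow> 'g set \<Rightarrow> ('s, 'g) scheme prog" where
  "greedy_prog I T = do {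
     \<phi> \<leftarrow> zero_prog I;
     A \<leftarrow> filter_prog (rejectable I) (within_prog I T);
     B \<leftarrow> filter_prog (rejectable I) (\<lambda>\<theta>. do {
         t \<leftarrow> touches_prog I T \<theta>; w \<leftarrow> within_prog I T \<theta>; eval (t \<and> \<not> w) });
     C \<leftarrow> filter_prog (rejectable I) (\<lambda>\<theta>. do { t \<leftarrow> touches_prog I T \<theta>; eval (\<not> t) });
     mA \<leftarrow> prior_sum_prog I A;
     mB \<leftarrow> prior_sum_prog I B;
     \<phi> \<leftarrow> foreach A (spread_prog I) \<phi>;
     (\<phi>, need, rest) \<leftarrow> foreach B (\<lambda>\<theta> (\<phi>, need, rest). do {
         X \<leftarrow> filter_prog (signals I) (\<lambda>\<sigma>. eval ((\<theta>, \<sigma>) \<in> edges I \<and> \<sigma> \<in> T));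
         Y \<leftarrow> filter_prog (signals I) (\<lambda>\<sigma>. eval ((\<theta>, \<sigma>) \<in> edges I \<and> \<sigma> \<notin> T));
         rest \<leftarrow> eval (rest - prior I \<theta>);
         x \<leftarrow> pick {max 0 (need - rest)..min need (prior I \<theta>)};
         \<phi> \<leftarrow> split_prog \<theta> X x \<phi>;
         \<phi> \<leftarrow> split_prog \<theta> Y (prior I \<theta> - x) \<phi>;
         eval (\<phi>, need - x, rest)
       }) (\<phi>, min (prior I (theta_a I)) (mA + mB) - mA, mB);
     (\<phi>, r) \<leftarrow> foreach T (\<lambda>\<sigma> (\<phi>, r). do {
         l \<leftarrow> load_prog I (rejectable I) \<sigma> \<phi>;
         eval (\<phi>((theta_a I, \<sigma>) := l), r - l)
       }) (\<phi>, prior I (theta_a I));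
     \<phi> \<leftarrow> split_prog (theta_a I) T r \<phi>;
     foreach C (spread_prog I) \<phi>
   }"

subsection \<open>Main loop\<close>

text \<open>A scheme in which exactly the signals of \<open>T\<close> are accepted exists only if \<open>\<theta>\<^sub>a\<close> may send all of
  them, whereas \<open>T\<close> may contain heavy signals that are not adjacent to \<open>\<theta>\<^sub>a\<close>. If there is no such
  scheme, the current one is kept.\<close>

definition improve_prog ::
    "('s, 'g) persuasion \<Rightarrow> 'g set \<Rightarrow> ('s, 'g) scheme \<Rightarrow> ('s, 'g) scheme prog" where
  "improve_prog I T \<phi> = do {
     u \<leftarrow> utility_prog I \<phi>;
     v \<leftarrow> nbrs_mass_prog I T;
     if u < min (2 * prior I (theta_a I)) v then do {
       t \<leftarrow> foreach (signals I) (\<lambda>\<sigma> t. eval (t \<and> (\<sigma> \<in> T \<longrightarrow> (theta_a I, \<sigma>) \<in> edges I))) True;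
       if t then greedy_prog I T ensuring optimal_consistent_scheme I T
       else ret \<phi> ensuring (\<lambda>_. \<nexists>\<psi>. consistent_scheme I T \<psi>)
     } else ret \<phi>
   }"

text \<open>The extension of \<open>S\<close> by signals of \<open>L = \<Sigma>\<^bsub><\<epsilon>\<^esub> \<inter> N(\<theta>\<^sub>a)\<close>. The loop is left by the third component as
  soon as no signal of \<open>L\<close> remains to be added.\<close>

definition extend_prog ::
    "('s, 'g) persuasion \<Rightarrow> 'g set \<Rightarrow> 'g set \<Rightarrow> ('s, 'g) scheme \<Rightarrow> ('s, 'g) scheme prog" where
  "extend_prog I L S \<phi> = do {
     (T, \<phi>, brk) \<leftarrow> while_loop
       (\<lambda>(T, \<phi>, brk). if brk then ret False
          else do { r \<leftarrow> captive_mass_prog I T; eval (r \<le> prior I (theta_a I)) })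
       (\<lambda>(T, \<phi>, brk). do {
          \<phi> \<leftarrow> improve_prog I T \<phi>;
          R \<leftarrow> filter_prog L (\<lambda>\<sigma>. eval (\<sigma> \<notin> T));
          if R = {} then ret (T, \<phi>, True)
          else do { \<sigma> \<leftarrow> pick R; eval (insert \<sigma> T, \<phi>, False) }
        })
       (S, \<phi>, False);
     ret \<phi>
   }"

definition heavy_prog :: "('s, 'g) persuasion \<Rightarrow> real \<Rightarrow> 'g set prog" where
  "heavy_prog I \<epsilon> =
     filter_prog (signals I) (\<lambda>\<sigma>. do {
         T \<leftarrow> filter_prog (signals I) (\<lambda>\<sigma>'. eval (\<sigma>' = \<sigma>));
         r \<leftarrow> captive_mass_prog I T;
         eval (r \<ge> \<epsilon> * prior I (theta_a I)) })
     ensuring (\<lambda>H. H = heavy I \<epsilon>)"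

text \<open>The subsets \<open>S\<close> of \<open>H\<close> with at most \<open>1/\<epsilon>\<close> elements, each one paired with its size. The innermost
  \<open>filter_prog\<close> copies \<open>S\<close>.\<close>

definition small_subsets_prog ::
    "('s, 'g) persuasion \<Rightarrow> real \<Rightarrow> 'g set \<Rightarrow> (nat \<times> 'g set) list prog" where
  "small_subsets_prog I \<epsilon> H =
     foreach H (\<lambda>\<sigma> Ss. foreach_list Ss (\<lambda>(k, S) Ss'.
         if real (k + 1) \<le> 1 / \<epsilon>
         then do {
           S' \<leftarrow> filter_prog (signals I) (\<lambda>\<sigma>'. eval (\<sigma>' \<in> S));
           eval ((k + 1, insert \<sigma> S') # Ss')
         } else ret Ss') Ss) [(0, {})]
     ensuring (\<lambda>Ss. distinct Ss \<and> set Ss = {(card S, S) |S. S \<subseteq> H \<and> real (card S) \<le> 1 / \<epsilon>})"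

definition algorithm_P :: "('s, 'g) persuasion \<Rightarrow> real \<Rightarrow> ('s, 'g) scheme prog" where
  "algorithm_P I \<epsilon> = do {
     H \<leftarrow> heavy_prog I \<epsilon>;
     L \<leftarrow> filter_prog (signals I) (\<lambda>\<sigma>. eval (\<sigma> \<notin> H \<and> (theta_a I, \<sigma>) \<in> edges I))
         ensuring (\<lambda>L. L = (signals I - heavy I \<epsilon>) \<inter> state_nbrs I (theta_a I));
     \<phi> \<leftarrow> arbitrary_scheme_prog I;
     Ss \<leftarrow> small_subsets_prog I \<epsilon> H;
     foreach_list Ss (\<lambda>(k, S). extend_prog I L S) \<phi>
   }"

end

theory Submission
  imports Defs
begin

text \<open>
  Let \<open>U\<close> be the accepted signals adjacent to \<open>\<theta>\<^sub>a\<close> in a scheme. The rejectable mass on \<open>U\<close> is at most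
  \<open>q\<^sub>a\<close>, so the mass captive to \<open>U\<close> is at most \<open>q\<^sub>a\<close> and the utility is at most
  \<open>min (2 q\<^sub>a) (mass of N(U))\<close>. Distinct signals have disjoint captive sets, hence \<open>U\<close> contains at most
  \<open>1/\<epsilon>\<close> heavy signals, and their set \<open>S\<close> is enumerated by the algorithm. Starting from \<open>S\<close>, either all
  light signals can be added, which yields a superset of \<open>U\<close>, or some light signal makes the captive
  mass exceed \<open>q\<^sub>a\<close>. In the latter case the set \<open>T\<close> before that step already has
  \<open>N(T)\<close> of mass at least \<open>q\<^sub>a + (1 - \<epsilon>) q\<^sub>a\<close>, and \<open>2 \<le> (1 + \<epsilon>) (2 - \<epsilon>)\<close>.

  The programs are treated with Hoare triples that also bound the time consumed. Each program run
  once per enumerated subset takes time polynomial in \<open>n m\<close>, and there are at most \<open>2 m powr (2/\<epsilon>)\<close>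
  such subsets.
\<close>

section \<open>Reasoning about programs\<close>

text \<open>The order in which light signals are added is arbitrary, so nothing is known about the
  sets passed through except that consecutive ones differ by one light signal. The analysis
  therefore looks only at the step at which the captive mass overflows. Removing the states captive
  to the new signal alone costs less than \<open>\<epsilon> * prior I a\<close>; the remaining
  captive states already touched the previous set, and the acceptable state contributes another
  \<open>prior I a\<close>. An enumerated \<open>S\<close> may contain heavy signals that the
  acceptable state cannot send, and then no consistent scheme exists. Such an \<open>S\<close> never
  comes from a competing scheme, since \<open>U\<close> contains adjacent signals only; the
  guarantee for \<open>S\<close> is phrased so that it is vacuous in this case. The amounts picked
  by the programs are arbitrary reals, so no postcondition determines a scheme. Only unchanged
  entries, signs and certain sums are tracked; in the greedy procedure these already fix the
  utility, which equals the upper bound for all competitors. That no run gets stuck has to be proved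
  as well: every \<open>pick\<close> needs a nonempty set and every \<open>ensuring\<close> a valid
  claim.\<close>

definition spec :: "'a prog \<Rightarrow> nat \<Rightarrow> ('a \<Rightarrow> bool) \<Rightarrow> bool" where
  "spec p t Q \<longleftrightarrow>
     (\<forall>b\<ge>t. p b \<noteq> {} \<and> (\<forall>r\<in>p b. \<exists>x b'. r = Some (x, b') \<and> b \<le> b' + t \<and> Q x))"

lemma spec_runs_within: "spec p t Q \<Longrightarrow> runs_within p t Q"
  unfolding spec_def runs_within_def by blast

lemma spec_mono: "spec p t P \<Longrightarrow> t \<le> t' \<Longrightarrow> (\<And>x. P x \<Longrightarrow> Q x) \<Longrightarrow> spec p t' Q"
  unfolding spec_def by (meson add_le_mono le_refl le_trans)

lemma spec_time_mono: "spec p t Q \<Longrightarrow> t \<le> t' \<Longrightarrow> spec p t' Q"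
  by (rule spec_mono)

lemma spec_ret: "Q x \<Longrightarrow> spec (ret x) t Q"
  by (auto simp: spec_def ret_def)

lemma spec_tick: "spec tick 1 (\<lambda>_. True)"
  by (auto simp: spec_def tick_def)

lemma spec_pick: "X \<noteq> {} \<Longrightarrow> spec (pick X) 1 (\<lambda>x. x \<in> X)"
  by (auto simp: spec_def pick_def)

text \<open>A run of \<open>p\<close> started with budget \<open>b\<close> leaves at least
  \<open>b - t\<close>, which still covers \<open>t'\<close> for the continuation. This is why
  \<open>spec\<close> quantifies over all sufficient budgets and records what is left, whereas
  \<open>runs_within\<close> inspects a single budget and would not compose.\<close>

lemma spec_bind:
  assumes p: "spec p t P" and f: "\<And>x. P x \<Longrightarrow> spec (f x) t' Q"
  shows "spec (prog_bind p f) (t + t') Q"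
  unfolding spec_def
proof (intro allI impI)
  fix b assume b: "t + t' \<le> b"
  have outcome: "\<exists>x b'. r = Some (x, b') \<and> b \<le> b' + t \<and> P x" if "r \<in> p b" for r
    using p b that unfolding spec_def by (meson add_leD1)
  have cont: "f x b' \<noteq> {} \<and> (\<forall>r\<in>f x b'. \<exists>y b''. r = Some (y, b'') \<and> b \<le> b'' + (t + t') \<and> Q y)"
    if "P x" "b \<le> b' + t" for x b'
  proof -
    have "t' \<le> b'" using b that by linarith
    then have "f x b' \<noteq> {}" and "\<forall>r\<in>f x b'. \<exists>y b''. r = Some (y, b'') \<and> b' \<le> b'' + t' \<and> Q y"
      using f[OF \<open>P x\<close>] unfolding spec_def by blast+
    then show ?thesis using that by fastforce
  qed
  obtain r where r: "r \<in> p b"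
    using p b unfolding spec_def by (metis add_leD1 all_not_in_conv)
  obtain x b' where x: "r = Some (x, b')" "b \<le> b' + t" "P x" using outcome[OF r] by blast
  have "f x b' \<subseteq> prog_bind p f b"
    using r x(1) unfolding prog_bind_def by force
  then have "prog_bind p f b \<noteq> {}" using cont[OF x(3,2)] by blast
  moreover have "\<exists>y b''. r' = Some (y, b'') \<and> b \<le> b'' + (t + t') \<and> Q y"
    if r': "r' \<in> prog_bind p f b" for r'
  proof -
    from r' obtain r0 where r0: "r0 \<in> p b"
      and r'': "r' \<in> (case r0 of None \<Rightarrow> {None} | Some (x, b') \<Rightarrow> f x b')"
      unfolding prog_bind_def by blast
    obtain x b' where "r0 = Some (x, b')" "b \<le> b' + t" "P x" using outcome[OF r0] by blast
    with r'' cont[of x b'] show ?thesis by simp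
  qed
  ultimately show "prog_bind p f b \<noteq> {} \<and>
      (\<forall>r\<in>prog_bind p f b. \<exists>x b'. r = Some (x, b') \<and> b \<le> b' + (t + t') \<and> Q x)" by blast
qed

lemma spec_bind_le:
  "spec p t P \<Longrightarrow> (\<And>x. P x \<Longrightarrow> spec (f x) t' Q) \<Longrightarrow> t + t' \<le> t'' \<Longrightarrow> spec (prog_bind p f) t'' Q"
  using spec_time_mono[OF spec_bind] .

lemma spec_eval: "Q x \<Longrightarrow> 0 < t \<Longrightarrow> spec (eval x) t Q"
  unfolding eval_def
  by (rule spec_bind_le[OF spec_tick spec_ret[where t = 0]]) auto

text \<open>The claim turns into a proof obligation, because a violation would produce the outcome
  \<open>None\<close>. The postcondition remains \<open>P\<close>, which implies \<open>Q\<close>,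
  and the check costs no time.\<close>

lemma spec_ensuring:
  assumes "spec p t P" and "\<And>x. P x \<Longrightarrow> Q x"
  shows "spec (p ensuring Q) t P"
  unfolding ensuring_def
  by (rule spec_time_mono[OF spec_bind[OF assms(1), where t' = 0]])
    (auto simp: assms(2) intro: spec_ret)

lemma spec_visit:
  assumes "\<And>zs x ws a. xs = zs @ x # ws \<Longrightarrow> Inv zs a \<Longrightarrow> spec (f x a) t (Inv (zs @ [x]))"
    and "Inv [] a"
  shows "spec (visit xs f a) (length xs * (t + 1)) (Inv xs)"
  using assms
proof (induction xs arbitrary: a Inv)
  case Nil
  then show ?case by (simp add: spec_ret)
next
  case (Cons x xs)
  have rest: "spec (visit xs f a') (length xs * (t + 1)) (Inv (x # xs))" if "Inv [x] a'" for a'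
    using Cons.IH[of "\<lambda>zs. Inv (x # zs)" a'] Cons.prems(1)[of "x # _"] that by simp
  have "spec (f x a) t (Inv [x])" using Cons.prems(1)[of "[]" x xs a] Cons.prems(2) by simp
  then have "spec (visit (x # xs) f a) (1 + (t + length xs * (t + 1))) (Inv (x # xs))"
    unfolding visit.simps by (intro spec_bind[OF spec_tick] spec_bind[where P = "Inv [x]"] rest)
  then show ?case by (rule spec_time_mono) simp
qed

text \<open>The invariant refers to the set of visited elements and not to a list, so that one
  argument serves every enumeration of \<open>X\<close>. The extra unit per element is the tick of
  \<open>visit\<close>.\<close>

lemma spec_foreach:
  assumes fin: "finite X"
    and step: "\<And>V x a. V \<subseteq> X \<Longrightarrow> x \<in> X - V \<Longrightarrow> Inv V a \<Longrightarrow> spec (f x a) t (Inv (insert x V))"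
    and init: "Inv {} a"
  shows "spec (foreach X f a) (card X * (t + 1)) (Inv X)"
proof -
  have visit: "spec (visit xs f a) (card X * (t + 1)) (Inv X)" if xs: "distinct xs" "set xs = X" for xs
  proof -
    have "spec (visit xs f a) (length xs * (t + 1)) ((\<lambda>zs. Inv (set zs)) xs)"
    proof (rule spec_visit)
      fix zs x ws a assume eq: "xs = zs @ x # ws" and inv: "Inv (set zs) a"
      have "set zs \<subseteq> X" "x \<in> X - set zs" using xs eq by auto
      then show "spec (f x a) t (Inv (set (zs @ [x])))" using step[OF _ _ inv] by simp
    qed (simp add: init)
    then show ?thesis using xs distinct_card by fastforce
  qed
  obtain xs0 where "distinct xs0" "set xs0 = X" using finite_distinct_list[OF fin] by blast
  then show ?thesis
    using visit fin unfolding spec_def foreach_def by (auto; blast)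
qed

text \<open>The rearrangements of a duplicate-free list are exactly the enumerations of its set. The
  loops over the list of subsets can therefore use the rule for sets.\<close>

lemma foreach_list_distinct: "distinct xs \<Longrightarrow> foreach_list xs = foreach (set xs)"
proof (intro ext)
  fix f :: "'a \<Rightarrow> 'b \<Rightarrow> 'b prog" and a b
  assume "distinct xs"
  then have "{ys. mset ys = mset xs} = {ys. distinct ys \<and> set ys = set xs}"
    by (auto dest: mset_eq_setD mset_eq_imp_distinct_iff simp: set_eq_iff_mset_eq_distinct)
  then show "foreach_list xs f a b = foreach (set xs) f a b"
    by (simp add: foreach_list_def foreach_def)
qed

text \<open>The measure bounds the number of executions of the body; the additional iteration in
  \<open>\<mu> a + 1\<close> is the final test that leaves the loop.\<close>

lemma spec_while_fuel:
  assumes cond: "\<And>a. Inv a \<Longrightarrow> spec (c a) tc (\<lambda>r. if r then G a else Q a)"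
    and body: "\<And>a. Inv a \<Longrightarrow> G a \<Longrightarrow> spec (f a) tf (\<lambda>a'. Inv a' \<and> (\<mu> a' :: nat) < \<mu> a)"
  shows "Inv a \<Longrightarrow> \<mu> a < k \<Longrightarrow> spec (while_fuel k c f a) ((\<mu> a + 1) * (1 + tc + tf)) Q"
proof (induction k arbitrary: a)
  case 0
  then show ?case by simp
next
  case (Suc k)
  have again: "spec (while_fuel k c f a') (\<mu> a * (1 + tc + tf)) Q" if "Inv a'" "\<mu> a' < \<mu> a" for a'
  proof (rule spec_time_mono)
    show "spec (while_fuel k c f a') ((\<mu> a' + 1) * (1 + tc + tf)) Q"
      using Suc that by simp
    show "(\<mu> a' + 1) * (1 + tc + tf) \<le> \<mu> a * (1 + tc + tf)"
      using that by (intro mult_le_mono1) simp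
  qed
  have "spec (while_fuel (Suc k) c f a) (1 + (tc + (tf + \<mu> a * (1 + tc + tf)))) Q"
    unfolding while_fuel.simps
  proof (rule spec_bind[OF spec_tick], rule spec_bind[OF cond[OF Suc.prems(1)]])
    fix r :: bool assume "if r then G a else Q a"
    then show "spec (if r then prog_bind (f a) (while_fuel k c f) else ret a) (tf + \<mu> a * (1 + tc + tf)) Q"
      using spec_bind[OF body[OF Suc.prems(1)], of "while_fuel k c f"] again
      by (cases r) (auto intro: spec_ret)
  qed
  then show ?case by (rule spec_time_mono) (simp add: algebra_simps)
qed

lemma spec_while:
  assumes "\<And>a. Inv a \<Longrightarrow> spec (c a) tc (\<lambda>r. if r then G a else Q a)"
    and "\<And>a. Inv a \<Longrightarrow> G a \<Longrightarrow> spec (f a) tf (\<lambda>a'. Inv a' \<and> (\<mu> a' :: nat) < \<mu> a)"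
    and "Inv a"
  shows "spec (while_loop c f a) ((\<mu> a + 1) * (1 + tc + tf)) Q"
proof -
  \<comment> \<open>The fuel is tied to the budget: each of the \<open>\<mu> a + 1\<close>
    iterations is charged at least one unit, so a sufficient budget is also sufficient fuel.\<close>
  have enough: "\<mu> a < Suc b" if "(\<mu> a + 1) * (1 + tc + tf) \<le> b" for b
    using that by (simp add: algebra_simps)
  have "spec (while_fuel (Suc b) c f a) ((\<mu> a + 1) * (1 + tc + tf)) Q"
    if "(\<mu> a + 1) * (1 + tc + tf) \<le> b" for b
    by (rule spec_while_fuel[where Inv = Inv and G = G, OF assms(1,2,3) enough[OF that]])
  then show ?thesis
    unfolding spec_def[of "while_loop c f a"] while_loop_def unfolding spec_def by blast
qed

lemma spec_filter:
  assumes fin: "finite X" and P: "\<And>x. x \<in> X \<Longrightarrow> spec (P x) t (\<lambda>r. r \<longleftrightarrow> R x)"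
  shows "spec (filter_prog X P) (card X * (t + 2)) (\<lambda>Y. Y = {x\<in>X. R x})"
proof -
  have "spec (filter_prog X P) (card X * ((t + 1) + 1)) ((\<lambda>V Y. Y = {x\<in>V. R x}) X)"
    unfolding filter_prog_def
  proof (rule spec_foreach[OF fin])
    fix V x Y assume "x \<in> X - V" and Y: "Y = {x\<in>V. R x}"
    then show "spec (prog_bind (P x) (\<lambda>t. eval (if t then insert x Y else Y))) (t + 1)
        (\<lambda>Y. Y = {x'\<in>insert x V. R x'})"
      by (intro spec_bind[OF P] spec_eval) auto
  qed simp
  then show ?thesis by simp
qed

lemma spec_fold_prog:
  assumes "finite X"
  shows "spec (foreach X (\<lambda>x a. eval (a + g x)) 0) (card X * 2) (\<lambda>a. a = (\<Sum>x\<in>X. g x :: 'a :: comm_monoid_add))"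
proof -
  have "spec (foreach X (\<lambda>x a. eval (a + g x)) 0) (card X * (1 + 1)) ((\<lambda>V a. a = (\<Sum>x\<in>V. g x)) X)"
  proof (rule spec_foreach[OF assms], goal_cases)
    case (1 V x a)
    then have "finite V" using assms finite_subset by blast
    then show ?case using 1 by (intro spec_eval) (auto simp: add.commute)
  qed simp
  then show ?thesis by (rule spec_time_mono) simp
qed

lemma spec_all_prog:
  assumes "finite X"
  shows "spec (foreach X (\<lambda>x t. eval (t \<and> R x)) True) (card X * 2) (\<lambda>t. t \<longleftrightarrow> (\<forall>x\<in>X. R x))"
proof -
  have "spec (foreach X (\<lambda>x t. eval (t \<and> R x)) True) (card X * (1 + 1)) ((\<lambda>V t. t \<longleftrightarrow> (\<forall>x\<in>V. R x)) X)"
    by (rule spec_foreach[OF assms]; (rule spec_eval)?) auto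
  then show ?thesis by (rule spec_time_mono) simp
qed

lemma spec_ex_prog:
  assumes "finite X"
  shows "spec (foreach X (\<lambda>x t. eval (t \<or> R x)) False) (card X * 2) (\<lambda>t. t \<longleftrightarrow> (\<exists>x\<in>X. R x))"
proof -
  have "spec (foreach X (\<lambda>x t. eval (t \<or> R x)) False) (card X * (1 + 1)) ((\<lambda>V t. t \<longleftrightarrow> (\<exists>x\<in>V. R x)) X)"
    by (rule spec_foreach[OF assms]; (rule spec_eval)?) auto
  then show ?thesis by (rule spec_time_mono) simp
qed

section \<open>Bounds on the utility\<close>

locale unique_accepts =
  fixes I :: "('s, 'g) persuasion"
  assumes inst: "persuasion_instance I" and unique: "card (acceptable I) = 1"
begin

abbreviation a where "a \<equiv> theta_a I"
abbreviation mass where "mass A \<equiv> sum (prior I) A"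

definition rload :: "('s, 'g) scheme \<Rightarrow> 'g \<Rightarrow> real" where
  "rload \<phi> \<sigma> = (\<Sum>\<theta>\<in>signal_nbrs I \<sigma> \<inter> rejectable I. \<phi> (\<theta>, \<sigma>))"

text \<open>The scheme condition at a single state, without the upper bound on the entries. Loops
  over states establish it one state at a time.\<close>

definition row :: "('s, 'g) scheme \<Rightarrow> 's \<Rightarrow> bool" where
  "row \<phi> \<theta> \<longleftrightarrow> (\<forall>\<sigma>\<in>state_nbrs I \<theta>. 0 \<le> \<phi> (\<theta>, \<sigma>)) \<and> (\<Sum>\<sigma>\<in>state_nbrs I \<theta>. \<phi> (\<theta>, \<sigma>)) = prior I \<theta>"

lemma acceptable_eq: "acceptable I = {a}"
  using unique unfolding theta_a_def by (metis card_1_singletonE the_elem_eq)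

lemma states_eq: "states I = insert a (rejectable I)"
  by (simp add: states_def acceptable_eq)

lemma a_states: "a \<in> states I"
  by (simp add: states_eq)

lemma a_not_rejectable: "a \<notin> rejectable I"
  using inst unfolding persuasion_instance_def acceptable_eq by blast

lemma finite_states: "finite (states I)" and finite_signals: "finite (signals I)"
  using inst unfolding persuasion_instance_def by blast+

lemma finite_rejectable: "finite (rejectable I)"
  using finite_states by (simp add: states_eq)

lemma rejectable_states: "rejectable I \<subseteq> states I"
  by (auto simp: states_eq)

lemma prior_pos: "\<theta> \<in> states I \<Longrightarrow> 0 < prior I \<theta>"
  using inst unfolding persuasion_instance_def by blast

lemma prior_nonneg: "\<theta> \<in> states I \<Longrightarrow> 0 \<le> prior I \<theta>"
  using prior_pos by (simp add: less_imp_le)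

lemma edgesD: "(\<theta>, \<sigma>) \<in> edges I \<Longrightarrow> \<theta> \<in> states I \<and> \<sigma> \<in> signals I"
  using inst unfolding persuasion_instance_def by blast

lemma state_nbrs_subset: "state_nbrs I \<theta> \<subseteq> signals I"
  by (auto simp: state_nbrs_def dest: edgesD)

lemma signal_nbrs_subset: "signal_nbrs I \<sigma> \<subseteq> states I"
  by (auto simp: signal_nbrs_def dest: edgesD)

lemma set_nbrs_subset: "set_nbrs I T \<subseteq> states I"
  using signal_nbrs_subset by (auto simp: set_nbrs_def)

lemma captive_subset: "captive I T \<subseteq> rejectable I"
  by (auto simp: captive_def)

lemma state_nbrs_nonempty: "\<theta> \<in> states I \<Longrightarrow> state_nbrs I \<theta> \<noteq> {}"
  using inst unfolding persuasion_instance_def state_nbrs_def by blast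

lemma finite_state_nbrs: "finite (state_nbrs I \<theta>)"
  using finite_signals state_nbrs_subset finite_subset by blast

lemma finite_signal_nbrs: "finite (signal_nbrs I \<sigma>)"
  using finite_states signal_nbrs_subset finite_subset by blast

lemma finite_set_nbrs: "finite (set_nbrs I T)"
  using finite_states set_nbrs_subset finite_subset by blast

lemma finite_captive: "finite (captive I T)"
  using finite_rejectable captive_subset finite_subset by blast

lemma mem_nbrs_iff: "\<sigma> \<in> state_nbrs I \<theta> \<longleftrightarrow> \<theta> \<in> signal_nbrs I \<sigma>"
  by (simp add: state_nbrs_def signal_nbrs_def)

lemma mass_mono: "A \<subseteq> B \<Longrightarrow> B \<subseteq> states I \<Longrightarrow> mass A \<le> mass B"
  using finite_states prior_nonneg by (intro sum_mono2) (auto dest: finite_subset)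

lemma aload_eq:
  "(\<Sum>\<theta>\<in>signal_nbrs I \<sigma> \<inter> acceptable I. \<phi> (\<theta>, \<sigma>)) = (if \<sigma> \<in> state_nbrs I a then \<phi> (a, \<sigma>) else 0)"
  by (auto simp: acceptable_eq mem_nbrs_iff)

lemma accept_signal_iff:
  "accept_signal I \<phi> \<sigma> \<longleftrightarrow> rload \<phi> \<sigma> \<le> (if \<sigma> \<in> state_nbrs I a then \<phi> (a, \<sigma>) else 0)"
  unfolding accept_signal_def aload_eq rload_def ..

lemma signal_load:
  "(\<Sum>\<theta>\<in>signal_nbrs I \<sigma>. \<phi> (\<theta>, \<sigma>)) = (if \<sigma> \<in> state_nbrs I a then \<phi> (a, \<sigma>) else 0) + rload \<phi> \<sigma>"
proof -
  have "signal_nbrs I \<sigma> = signal_nbrs I \<sigma> \<inter> acceptable I \<union> signal_nbrs I \<sigma> \<inter> rejectable I"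
    using signal_nbrs_subset[of \<sigma>] by (auto simp: states_def)
  then have "(\<Sum>\<theta>\<in>signal_nbrs I \<sigma>. \<phi> (\<theta>, \<sigma>)) =
      (\<Sum>\<theta>\<in>signal_nbrs I \<sigma> \<inter> acceptable I \<union> signal_nbrs I \<sigma> \<inter> rejectable I. \<phi> (\<theta>, \<sigma>))" by simp
  also have "\<dots> = (\<Sum>\<theta>\<in>signal_nbrs I \<sigma> \<inter> acceptable I. \<phi> (\<theta>, \<sigma>)) + rload \<phi> \<sigma>"
    unfolding rload_def
    by (rule sum.union_disjoint) (use finite_signal_nbrs a_not_rejectable in \<open>auto simp: acceptable_eq\<close>)
  finally show ?thesis by (simp add: aload_eq)
qed

lemma row_le_prior:
  assumes "row \<phi> \<theta>" "U \<subseteq> state_nbrs I \<theta>"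
  shows "(\<Sum>\<sigma>\<in>U. \<phi> (\<theta>, \<sigma>)) \<le> prior I \<theta>"
proof -
  have "(\<Sum>\<sigma>\<in>U. \<phi> (\<theta>, \<sigma>)) \<le> (\<Sum>\<sigma>\<in>state_nbrs I \<theta>. \<phi> (\<theta>, \<sigma>))"
    using assms finite_state_nbrs by (intro sum_mono2) (auto simp: row_def)
  then show ?thesis using assms by (simp add: row_def)
qed

text \<open>What \<open>row\<close> omits is the upper bound 1 on the entries. By nonnegativity an
  entry is at most the prior of its state, and the priors sum to 1.\<close>

lemma signaling_scheme_iff: "signaling_scheme I \<phi> \<longleftrightarrow> (\<forall>\<theta>\<in>states I. row \<phi> \<theta>)"
proof
  assume "signaling_scheme I \<phi>"
  then show "\<forall>\<theta>\<in>states I. row \<phi> \<theta>"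
    by (auto simp: signaling_scheme_def row_def state_nbrs_def)
next
  assume rows: "\<forall>\<theta>\<in>states I. row \<phi> \<theta>"
  have "0 \<le> \<phi> (\<theta>, \<sigma>) \<and> \<phi> (\<theta>, \<sigma>) \<le> 1" if e: "(\<theta>, \<sigma>) \<in> edges I" for \<theta> \<sigma>
  proof -
    have \<theta>: "\<theta> \<in> states I" and \<sigma>: "\<sigma> \<in> state_nbrs I \<theta>"
      using e edgesD by (auto simp: state_nbrs_def)
    have "\<phi> (\<theta>, \<sigma>) \<le> prior I \<theta>" using row_le_prior[of \<phi> \<theta> "{\<sigma>}"] rows \<theta> \<sigma> by simp
    also have "\<dots> \<le> mass (states I)"
      using \<theta> prior_nonneg finite_states by (intro member_le_sum) auto
    also have "\<dots> = 1" using inst by (simp add: persuasion_instance_def)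
    finally show ?thesis using rows \<theta> \<sigma> by (auto simp: row_def)
  qed
  then show "signaling_scheme I \<phi>" using rows by (auto simp: signaling_scheme_def row_def)
qed

section \<open>Double counting along the edges and bounds on the accepted mass\<close>

lemma sum_swap_nbrs:
  assumes "finite U" "finite D"
  shows "(\<Sum>\<sigma>\<in>U. \<Sum>\<theta>\<in>signal_nbrs I \<sigma> \<inter> D. \<phi> (\<theta>, \<sigma>)) = (\<Sum>\<theta>\<in>D. \<Sum>\<sigma>\<in>state_nbrs I \<theta> \<inter> U. (\<phi> (\<theta>, \<sigma>) :: real))"
proof -
  have "signal_nbrs I \<sigma> \<inter> D = {\<theta>\<in>D. (\<theta>, \<sigma>) \<in> edges I}" for \<sigma> by (auto simp: signal_nbrs_def)
  moreover have "state_nbrs I \<theta> \<inter> U = {\<sigma>\<in>U. (\<theta>, \<sigma>) \<in> edges I}" for \<theta> by (auto simp: state_nbrs_def)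
  ultimately show ?thesis using sum.swap_restrict[OF assms] by simp
qed

lemma sum_rload:
  "finite U \<Longrightarrow> (\<Sum>\<sigma>\<in>U. rload \<phi> \<sigma>) = (\<Sum>\<theta>\<in>rejectable I. \<Sum>\<sigma>\<in>state_nbrs I \<theta> \<inter> U. \<phi> (\<theta>, \<sigma>))"
  unfolding rload_def by (rule sum_swap_nbrs[OF _ finite_rejectable])

text \<open>A state captive to \<open>U\<close> has no signal outside \<open>U\<close>, so its whole
  prior is part of the load on \<open>U\<close>; the other rejectable states contribute nonnegative
  amounts.\<close>

lemma captive_le_rload:
  assumes "signaling_scheme I \<phi>" "finite U"
  shows "mass (captive I U) \<le> (\<Sum>\<sigma>\<in>U. rload \<phi> \<sigma>)"
proof -
  have "mass (captive I U) = (\<Sum>\<theta>\<in>captive I U. \<Sum>\<sigma>\<in>state_nbrs I \<theta> \<inter> U. \<phi> (\<theta>, \<sigma>))"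
  proof (rule sum.cong[OF refl])
    fix \<theta> assume "\<theta> \<in> captive I U"
    then have "row \<phi> \<theta>" "state_nbrs I \<theta> \<inter> U = state_nbrs I \<theta>"
      using assms(1) rejectable_states by (auto simp: captive_def signaling_scheme_iff)
    then show "prior I \<theta> = (\<Sum>\<sigma>\<in>state_nbrs I \<theta> \<inter> U. \<phi> (\<theta>, \<sigma>))" by (simp add: row_def)
  qed
  also have "\<dots> \<le> (\<Sum>\<theta>\<in>rejectable I. \<Sum>\<sigma>\<in>state_nbrs I \<theta> \<inter> U. \<phi> (\<theta>, \<sigma>))"
    using assms(1) rejectable_states captive_subset finite_rejectable
    by (intro sum_mono2) (auto intro!: sum_nonneg simp: signaling_scheme_iff row_def)
  finally show ?thesis using assms(2) by (simp add: sum_rload)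
qed

text \<open>On each accepted signal the rejectable load is at most the load of the acceptable state,
  which has only \<open>prior I a\<close> to distribute. Summation gives the first claim and the
  factor 2 in the second. The bound by the neighborhood counts the same mass state by state.\<close>

lemma accept_bounds:
  assumes \<phi>: "signaling_scheme I \<phi>" and U: "U \<subseteq> signals I" and acc: "\<And>\<sigma>. \<sigma> \<in> U \<Longrightarrow> accept_signal I \<phi> \<sigma>"
  shows "(\<Sum>\<sigma>\<in>U. rload \<phi> \<sigma>) \<le> prior I a"
    and "(\<Sum>\<sigma>\<in>U. \<Sum>\<theta>\<in>signal_nbrs I \<sigma>. \<phi> (\<theta>, \<sigma>)) \<le> min (2 * prior I a) (mass (set_nbrs I U))"
proof -
  have fin: "finite U" using U finite_signals finite_subset by blast
  let ?al = "\<lambda>\<sigma>. if \<sigma> \<in> state_nbrs I a then \<phi> (a, \<sigma>) else 0"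
  have al: "(\<Sum>\<sigma>\<in>U. ?al \<sigma>) \<le> prior I a"
  proof -
    have "(\<Sum>\<sigma>\<in>U. ?al \<sigma>) = (\<Sum>\<sigma>\<in>U \<inter> state_nbrs I a. \<phi> (a, \<sigma>))"
      using fin by (simp add: sum.inter_restrict)
    also have "\<dots> \<le> prior I a"
      using \<phi> a_states by (intro row_le_prior) (auto simp: signaling_scheme_iff)
    finally show ?thesis .
  qed
  have "(\<Sum>\<sigma>\<in>U. rload \<phi> \<sigma>) \<le> (\<Sum>\<sigma>\<in>U. ?al \<sigma>)"
    using acc by (intro sum_mono) (simp only: accept_signal_iff)
  then show rl: "(\<Sum>\<sigma>\<in>U. rload \<phi> \<sigma>) \<le> prior I a" using al by linarith
  have "(\<Sum>\<sigma>\<in>U. \<Sum>\<theta>\<in>signal_nbrs I \<sigma>. \<phi> (\<theta>, \<sigma>)) \<le> 2 * prior I a"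
    using al rl unfolding signal_load sum.distrib by linarith
  moreover have "(\<Sum>\<sigma>\<in>U. \<Sum>\<theta>\<in>signal_nbrs I \<sigma>. \<phi> (\<theta>, \<sigma>)) \<le> mass (set_nbrs I U)"
  proof -
    have "(\<Sum>\<sigma>\<in>U. \<Sum>\<theta>\<in>signal_nbrs I \<sigma>. \<phi> (\<theta>, \<sigma>)) = (\<Sum>\<sigma>\<in>U. \<Sum>\<theta>\<in>signal_nbrs I \<sigma> \<inter> set_nbrs I U. \<phi> (\<theta>, \<sigma>))"
      by (intro sum.cong refl) (auto simp: set_nbrs_def)
    also have "\<dots> = (\<Sum>\<theta>\<in>set_nbrs I U. \<Sum>\<sigma>\<in>state_nbrs I \<theta> \<inter> U. \<phi> (\<theta>, \<sigma>))"
      by (rule sum_swap_nbrs[OF fin finite_set_nbrs])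
    also have "\<dots> \<le> mass (set_nbrs I U)"
      using \<phi> set_nbrs_subset by (intro sum_mono row_le_prior) (auto simp: signaling_scheme_iff)
    finally show ?thesis .
  qed
  ultimately show "(\<Sum>\<sigma>\<in>U. \<Sum>\<theta>\<in>signal_nbrs I \<sigma>. \<phi> (\<theta>, \<sigma>)) \<le> min (2 * prior I a) (mass (set_nbrs I U))"
    by simp
qed

lemma utility_eq:
  assumes "U \<subseteq> signals I" "\<And>\<sigma>. \<sigma> \<in> U \<Longrightarrow> accept_signal I \<phi> \<sigma>"
    and "\<And>\<sigma>. \<sigma> \<in> signals I - U \<Longrightarrow> accept_signal I \<phi> \<sigma> \<Longrightarrow> (\<Sum>\<theta>\<in>signal_nbrs I \<sigma>. \<phi> (\<theta>, \<sigma>)) = 0"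
  shows "utility I \<phi> = (\<Sum>\<sigma>\<in>U. \<Sum>\<theta>\<in>signal_nbrs I \<sigma>. \<phi> (\<theta>, \<sigma>))"
  unfolding utility_def
  by (rule sum.mono_neutral_right) (use assms finite_signals in auto)

lemma consistent_utility_le:
  assumes "consistent_scheme I T \<phi>" "T \<subseteq> signals I"
  shows "utility I \<phi> \<le> min (2 * prior I a) (mass (set_nbrs I T))"
proof -
  have "utility I \<phi> = (\<Sum>\<sigma>\<in>T. \<Sum>\<theta>\<in>signal_nbrs I \<sigma>. \<phi> (\<theta>, \<sigma>))"
    by (rule utility_eq[OF assms(2)]) (use assms(1) in \<open>auto simp: consistent_scheme_def\<close>)
  then show ?thesis using accept_bounds(2)[of \<phi> T] assms by (auto simp: consistent_scheme_def)
qed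

text \<open>An accept signal that the acceptable state cannot send has rejectable load at most 0,
  hence carries nothing. Discarding such signals loses no utility and leaves a set for which both
  bounds on accepted mass are available.\<close>

lemma utility_le_accepted:
  assumes \<phi>: "signaling_scheme I \<phi>"
  obtains U where "U \<subseteq> state_nbrs I a" "mass (captive I U) \<le> prior I a"
    "utility I \<phi> \<le> min (2 * prior I a) (mass (set_nbrs I U))"
proof
  let ?U = "{\<sigma>\<in>state_nbrs I a. accept_signal I \<phi> \<sigma>}"
  have sub: "?U \<subseteq> signals I" using state_nbrs_subset by blast
  have nonneg: "0 \<le> rload \<phi> \<sigma>" for \<sigma>
    using \<phi> rejectable_states unfolding rload_def
    by (intro sum_nonneg) (auto simp: signaling_scheme_iff row_def mem_nbrs_iff)
  have "(\<Sum>\<theta>\<in>signal_nbrs I \<sigma>. \<phi> (\<theta>, \<sigma>)) = 0" if "\<sigma> \<in> signals I - ?U" "accept_signal I \<phi> \<sigma>" for \<sigma>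
    using that nonneg[of \<sigma>] unfolding signal_load by (auto simp: accept_signal_iff)
  then have "utility I \<phi> = (\<Sum>\<sigma>\<in>?U. \<Sum>\<theta>\<in>signal_nbrs I \<sigma>. \<phi> (\<theta>, \<sigma>))"
    by (intro utility_eq[OF sub]) auto
  then show "utility I \<phi> \<le> min (2 * prior I a) (mass (set_nbrs I ?U))"
    using accept_bounds(2)[OF \<phi> sub] by simp
  have "finite ?U" using sub finite_signals finite_subset by blast
  then show "mass (captive I ?U) \<le> prior I a"
    using accept_bounds(1)[OF \<phi> sub] captive_le_rload[OF \<phi>, of ?U] by simp
qed blast

section \<open>Captive mass of heavy and light signals\<close>

lemma captive_mono: "T \<subseteq> U \<Longrightarrow> captive I T \<subseteq> captive I U"
  by (auto simp: captive_def)

lemma set_nbrs_mono: "T \<subseteq> U \<Longrightarrow> set_nbrs I T \<subseteq> set_nbrs I U"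
  by (auto simp: set_nbrs_def)

lemma captive_mass_mono: "T \<subseteq> U \<Longrightarrow> mass (captive I T) \<le> mass (captive I U)"
  using captive_subset rejectable_states by (intro mass_mono captive_mono) auto

lemma card_heavy_le:
  assumes S: "S \<subseteq> heavy I \<epsilon>" and cap: "mass (captive I S) \<le> prior I a" and \<epsilon>: "0 < \<epsilon>"
  shows "real (card S) \<le> 1 / \<epsilon>"
proof -
  have fin: "finite S" using S finite_signals by (auto simp: heavy_def intro: finite_subset)
  have "real (card S) * (\<epsilon> * prior I a) \<le> (\<Sum>\<sigma>\<in>S. mass (captive I {\<sigma>}))"
    using S by (intro sum_bounded_below) (auto simp: heavy_def)
  also have "\<dots> = mass (\<Union>\<sigma>\<in>S. captive I {\<sigma>})"
  proof (rule sum.UNION_disjoint[symmetric, OF fin], intro ballI finite_captive, intro ballI impI)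
    fix \<sigma> \<sigma>' :: 'g assume ne: "\<sigma> \<noteq> \<sigma>'"
    \<comment> \<open>A state captive to two different signals would have no signal at all, which is
      excluded because there are no isolated vertices.\<close>
    have "state_nbrs I \<theta> = {}" if "\<theta> \<in> captive I {\<sigma>} \<inter> captive I {\<sigma>'}" for \<theta>
      using that ne by (auto simp: captive_def)
    then show "captive I {\<sigma>} \<inter> captive I {\<sigma>'} = {}"
      using state_nbrs_nonempty captive_subset rejectable_states by blast
  qed
  also have "\<dots> \<le> mass (captive I S)"
    using captive_subset rejectable_states by (intro mass_mono) (auto simp: captive_def)
  finally have "real (card S) * \<epsilon> * prior I a \<le> 1 * prior I a" using cap by (simp add: mult.assoc)
  then have "real (card S) * \<epsilon> \<le> 1" using prior_pos[OF a_states] by (rule mult_right_le_imp_le)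
  then show ?thesis using \<epsilon> by (simp add: field_simps)
qed

text \<open>The last feasible set before a light signal \<open>\<sigma>\<close> makes the captive mass exceed \<open>\<theta>\<^sub>a\<close>'s:
  every state that is captive afterwards is adjacent to \<open>T\<close>, except those captive to \<open>\<sigma>\<close> alone.\<close>

lemma overflow_bound:
  assumes T: "T \<subseteq> state_nbrs I a" and over: "prior I a < mass (captive I (insert \<sigma> T))"
    and light: "mass (captive I {\<sigma>}) < \<epsilon> * prior I a" and \<epsilon>: "0 < \<epsilon>" "\<epsilon> \<le> 1"
  shows "2 * prior I a \<le> (1 + \<epsilon>) * min (2 * prior I a) (mass (set_nbrs I T))"
proof -
  have pos: "0 < prior I a" using prior_pos[OF a_states] .
  have "\<epsilon> * prior I a \<le> prior I a" using pos \<epsilon> by simp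
  \<comment> \<open>For empty \<open>T\<close> the captive mass after the insertion would be that of
    \<open>\<sigma>\<close> alone, which stays below \<open>prior I a\<close>. Nonemptiness places
    \<open>a\<close> in the neighborhood of \<open>T\<close>.\<close>
  then have "T \<noteq> {}" using light over by auto
  then have aT: "a \<in> set_nbrs I T" using T by (auto simp: set_nbrs_def mem_nbrs_iff[symmetric])
  let ?D = "captive I (insert \<sigma> T) - captive I {\<sigma>}"
  have D: "insert a ?D \<subseteq> set_nbrs I T"
    using aT by (auto simp: captive_def set_nbrs_def signal_nbrs_def state_nbrs_def)
  have "mass ?D = mass (captive I (insert \<sigma> T)) - mass (captive I {\<sigma>})"
    by (rule sum_diff[OF finite_captive captive_mono]) simp
  moreover have "mass (insert a ?D) = prior I a + mass ?D"
    using finite_captive a_not_rejectable by (subst sum.insert) (auto simp: captive_def)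
  moreover have "mass (insert a ?D) \<le> mass (set_nbrs I T)"
    using D set_nbrs_subset by (rule mass_mono)
  ultimately have big: "(2 - \<epsilon>) * prior I a \<le> mass (set_nbrs I T)"
    using over light by (simp add: algebra_simps)
  have "\<epsilon> * \<epsilon> \<le> \<epsilon>" using \<epsilon> by (simp add: mult_left_le)
  then have "2 \<le> (1 + \<epsilon>) * (2 - \<epsilon>)" by (simp add: algebra_simps)
  then have "2 * prior I a \<le> (1 + \<epsilon>) * (2 - \<epsilon>) * prior I a" using pos by (intro mult_right_mono) auto
  also have "\<dots> = (1 + \<epsilon>) * ((2 - \<epsilon>) * prior I a)" by simp
  also have "\<dots> \<le> (1 + \<epsilon>) * min (2 * prior I a) (mass (set_nbrs I T))"
    using big pos \<epsilon> by (intro mult_left_mono) auto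
  finally show ?thesis .
qed

text \<open>A heavy signal is forced to carry its positive captive mass. If the acceptable state
  cannot send it, nothing offsets this mass and the signal is rejected in every scheme.\<close>

lemma no_consistent_scheme:
  assumes \<sigma>: "\<sigma> \<in> T" "\<sigma> \<in> heavy I \<epsilon>" "\<sigma> \<notin> state_nbrs I a" and \<epsilon>: "0 < \<epsilon>"
  shows "\<not> consistent_scheme I T \<phi>"
proof
  assume "consistent_scheme I T \<phi>"
  then have \<phi>: "signaling_scheme I \<phi>" "rload \<phi> \<sigma> \<le> 0"
    using \<sigma> accept_signal_iff[of \<phi> \<sigma>] by (auto simp: consistent_scheme_def)
  have "\<epsilon> * prior I a \<le> rload \<phi> \<sigma>"
    using captive_le_rload[OF \<phi>(1), of "{\<sigma>}"] \<sigma>(2) by (simp add: heavy_def)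
  moreover have "0 < \<epsilon> * prior I a" using \<epsilon> prior_pos[OF a_states] by simp
  ultimately show False using \<phi>(2) by linarith
qed

end

section \<open>The elementary programs\<close>

text \<open>The postcondition of an arbitrary distribution: which entries stay, that no entry
  decreases, and the total added. How the mass is divided within \<open>X\<close> is deliberately
  left open.\<close>

definition adds :: "'s \<Rightarrow> 'g set \<Rightarrow> real \<Rightarrow> ('s, 'g) scheme \<Rightarrow> ('s, 'g) scheme \<Rightarrow> bool" where
  "adds \<theta> X x \<phi> \<phi>' \<longleftrightarrow>
     (\<forall>\<theta>' \<sigma>. \<theta>' \<noteq> \<theta> \<or> \<sigma> \<notin> X \<longrightarrow> \<phi>' (\<theta>', \<sigma>) = \<phi> (\<theta>', \<sigma>)) \<and>
     (\<forall>\<sigma>\<in>X. \<phi> (\<theta>, \<sigma>) \<le> \<phi>' (\<theta>, \<sigma>)) \<and>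
     (\<Sum>\<sigma>\<in>X. \<phi>' (\<theta>, \<sigma>)) = (\<Sum>\<sigma>\<in>X. \<phi> (\<theta>, \<sigma>)) + x"

lemma spec_split:
  assumes fin: "finite X" and ne: "X \<noteq> {}" and x: "0 \<le> x"
  shows "spec (split_prog \<theta> X x \<phi>) (card X * 3 + 2) (adds \<theta> X x \<phi>)"
proof -
  \<comment> \<open>Asserting \<open>adds\<close> for the visited signals only entails that an
    unvisited signal still has its original value, which the step needs. The remainder
    \<open>r\<close> is what has not been distributed so far.\<close>
  define Inv where "Inv = (\<lambda>V (\<phi>', r). 0 \<le> r \<and> adds \<theta> V (x - r) \<phi> \<phi>')"
  have loop: "spec (foreach X (\<lambda>\<sigma> (\<phi>, r). prog_bind (pick {0..r})
      (\<lambda>y. eval (\<phi>((\<theta>, \<sigma>) := \<phi> (\<theta>, \<sigma>) + y), r - y))) (\<phi>, x)) (card X * (2 + 1)) (Inv X)"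
  proof (rule spec_foreach[OF fin])
    show "Inv {} (\<phi>, x)" using x by (simp add: Inv_def adds_def)
  next
    fix V \<sigma> p assume V: "V \<subseteq> X" "\<sigma> \<in> X - V" and inv: "Inv V p"
    obtain \<phi>' r where p: "p = (\<phi>', r)" by force
    have r: "0 \<le> r" and adds: "adds \<theta> V (x - r) \<phi> \<phi>'" using inv by (auto simp: Inv_def p)
    have finV: "finite V" using V fin finite_subset by blast
    have "Inv (insert \<sigma> V) (\<phi>'((\<theta>, \<sigma>) := \<phi>' (\<theta>, \<sigma>) + y), r - y)" if y: "y \<in> {0..r}" for y
    proof -
      let ?\<psi> = "\<phi>'((\<theta>, \<sigma>) := \<phi>' (\<theta>, \<sigma>) + y)"
      have "(\<Sum>\<sigma>'\<in>V. ?\<psi> (\<theta>, \<sigma>')) = (\<Sum>\<sigma>'\<in>V. \<phi>' (\<theta>, \<sigma>'))"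
        using V by (intro sum.cong) auto
      then have "(\<Sum>\<sigma>'\<in>insert \<sigma> V. ?\<psi> (\<theta>, \<sigma>')) = \<phi>' (\<theta>, \<sigma>) + y + (\<Sum>\<sigma>'\<in>V. \<phi>' (\<theta>, \<sigma>'))"
        using V finV by simp
      moreover have "\<phi>' (\<theta>, \<sigma>) = \<phi> (\<theta>, \<sigma>)" using adds V by (simp add: adds_def)
      ultimately show ?thesis
        using adds y V finV by (auto simp: Inv_def adds_def)
    qed
    then show "spec (case p of (\<phi>, r) \<Rightarrow> prog_bind (pick {0..r})
        (\<lambda>y. eval (\<phi>((\<theta>, \<sigma>) := \<phi> (\<theta>, \<sigma>) + y), r - y))) 2 (Inv (insert \<sigma> V))"
      unfolding p prod.case by (intro spec_bind_le[OF spec_pick, where t' = 1] spec_eval) (use r in auto)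
  qed
  have finish: "spec (if r = 0 then ret \<phi>' else prog_bind (pick X)
      (\<lambda>\<sigma>. eval (\<phi>'((\<theta>, \<sigma>) := \<phi>' (\<theta>, \<sigma>) + r)))) 2 (adds \<theta> X x \<phi>)" if inv: "Inv X (\<phi>', r)" for \<phi>' r
  proof -
    have r: "0 \<le> r" and adds: "adds \<theta> X (x - r) \<phi> \<phi>'" using inv by (auto simp: Inv_def)
    have "adds \<theta> X x \<phi> (\<phi>'((\<theta>, \<sigma>) := \<phi>' (\<theta>, \<sigma>) + r))" if \<sigma>: "\<sigma> \<in> X" for \<sigma>
    proof -
      let ?\<psi> = "\<phi>'((\<theta>, \<sigma>) := \<phi>' (\<theta>, \<sigma>) + r)"
      have "(\<Sum>\<sigma>'\<in>X. ?\<psi> (\<theta>, \<sigma>')) = ?\<psi> (\<theta>, \<sigma>) + (\<Sum>\<sigma>'\<in>X - {\<sigma>}. ?\<psi> (\<theta>, \<sigma>'))"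
        using fin \<sigma> by (rule sum.remove)
      also have "(\<Sum>\<sigma>'\<in>X - {\<sigma>}. ?\<psi> (\<theta>, \<sigma>')) = (\<Sum>\<sigma>'\<in>X - {\<sigma>}. \<phi>' (\<theta>, \<sigma>'))" by (intro sum.cong) auto
      also have "?\<psi> (\<theta>, \<sigma>) + \<dots> = (\<Sum>\<sigma>'\<in>X. \<phi>' (\<theta>, \<sigma>')) + r"
        using sum.remove[OF fin \<sigma>, of "\<lambda>\<sigma>'. \<phi>' (\<theta>, \<sigma>')"] by simp
      finally show ?thesis using adds r \<sigma> by (auto simp: adds_def add_increasing2)
    qed
    then show ?thesis
      using adds ne by (cases "r = 0") (auto intro!: spec_ret spec_bind_le[OF spec_pick] spec_eval)
  qed
  show ?thesis
    unfolding split_prog_def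
    by (rule spec_bind_le[OF loop, where t' = 2]) (auto intro: finish)
qed

context unique_accepts
begin

text \<open>The product dominates both the number of states and the number of signals, so each
  running time is a constant times a power of one number. The two factors are separated again only
  in \<open>time_bound\<close>.\<close>

definition isize where "isize = card (states I) * card (signals I)"

lemma signals_nonempty: "signals I \<noteq> {}"
  using state_nbrs_nonempty[OF a_states] state_nbrs_subset by blast

lemma card_states_pos: "0 < card (states I)" and card_signals_pos: "0 < card (signals I)"
  using finite_states finite_signals a_states signals_nonempty by (auto simp: card_gt_0_iff)

text \<open>These inequalities let linear arithmetic absorb lower powers into higher ones while
  treating the powers as atoms.\<close>

lemma isize_powers: "1 \<le> isize" "isize \<le> isize ^ 2" "isize ^ 2 \<le> isize ^ 3"
proof -
  show "1 \<le> isize" using card_states_pos card_signals_pos by (simp add: isize_def Suc_le_eq)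
  then show "isize \<le> isize ^ 2" "isize ^ 2 \<le> isize ^ 3"
    by (auto simp: power2_eq_square power3_eq_cube)
qed

lemma card_states_le: "A \<subseteq> states I \<Longrightarrow> card A \<le> isize"
  using card_mono[OF finite_states] card_signals_pos unfolding isize_def
  by (metis Suc_leI One_nat_def mult.right_neutral mult_le_mono)

lemma card_signals_le: "X \<subseteq> signals I \<Longrightarrow> card X \<le> isize"
  using card_mono[OF finite_signals] card_states_pos unfolding isize_def
  by (metis Suc_leI One_nat_def mult.left_neutral mult_le_mono)

text \<open>The exponent of a time bound grows by one with each level of loop nesting, and the
  constant is kept.\<close>

lemma loop_le: "k \<le> isize \<Longrightarrow> t \<le> c * isize ^ i \<Longrightarrow> k * t \<le> c * isize ^ Suc i"
  using mult_le_mono[of k isize t "c * isize ^ i"] by (simp add: mult.left_commute)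

lemma loop_le2: "k \<le> isize \<Longrightarrow> t \<le> c * isize \<Longrightarrow> k * t \<le> c * isize ^ 2"
  using loop_le[of k t c 1] by (simp add: numeral_2_eq_2)

lemma loop_le3: "k \<le> isize \<Longrightarrow> t \<le> c * isize ^ 2 \<Longrightarrow> k * t \<le> c * isize ^ 3"
  using loop_le[of k t c 2] by (simp add: numeral_3_eq_3 numeral_2_eq_2)

lemma spec_filter_signals:
  assumes "X \<subseteq> signals I"
  shows "spec (filter_prog X (\<lambda>\<sigma>. eval (R \<sigma>))) (3 * isize) (\<lambda>Y. Y = {\<sigma>\<in>X. R \<sigma>})"
proof (rule spec_time_mono[OF spec_filter])
  show "card X * (1 + 2) \<le> 3 * isize" using card_signals_le[OF assms] by simp
qed (use assms finite_signals in \<open>auto intro: finite_subset spec_eval\<close>)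

lemma spec_within: "spec (within_prog I T \<theta>) (2 * isize) (\<lambda>t. t \<longleftrightarrow> state_nbrs I \<theta> \<subseteq> T)"
  unfolding within_prog_def
  by (rule spec_ensuring, rule spec_mono[OF spec_all_prog[OF finite_signals]])
    (use card_signals_le[of "signals I"] edgesD in \<open>auto simp: state_nbrs_def\<close>)

lemma spec_touches: "spec (touches_prog I T \<theta>) (2 * isize) (\<lambda>t. t \<longleftrightarrow> \<theta> \<in> set_nbrs I T)"
  unfolding touches_prog_def
  by (rule spec_ensuring, rule spec_mono[OF spec_ex_prog[OF finite_signals]])
    (use card_signals_le[of "signals I"] edgesD in \<open>auto simp: set_nbrs_def signal_nbrs_def\<close>)

lemma spec_filter_states:
  assumes "A \<subseteq> states I" "\<And>\<theta>. \<theta> \<in> A \<Longrightarrow> spec (P \<theta>) t (\<lambda>r. r \<longleftrightarrow> R \<theta>)" "t + 2 \<le> c * isize"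
  shows "spec (filter_prog A P) (c * isize ^ 2) (\<lambda>B. B = {\<theta>\<in>A. R \<theta>})"
proof (rule spec_time_mono[OF spec_filter[where t = t]])
  show "card A * (t + 2) \<le> c * isize ^ 2"
    using card_states_le[OF assms(1)] assms(3) by (rule loop_le2)
qed (use assms finite_states in \<open>auto intro: finite_subset\<close>)

lemma spec_prior_sum:
  assumes "A \<subseteq> states I"
  shows "spec (prior_sum_prog I A) (2 * isize) (\<lambda>s. s = mass A)"
  unfolding prior_sum_prog_def
  by (rule spec_time_mono[OF spec_fold_prog])
    (use assms finite_states card_states_le[OF assms] in \<open>auto intro: finite_subset\<close>)

lemma spec_captive_mass: "spec (captive_mass_prog I T) (6 * isize ^ 2) (\<lambda>s. s = mass (captive I T))"
  unfolding captive_mass_prog_def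
proof (rule spec_ensuring, rule spec_bind_le)
  show "spec (filter_prog (rejectable I) (within_prog I T)) (4 * isize ^ 2) (\<lambda>A. A = captive I T)"
    unfolding captive_def
    by (rule spec_filter_states[OF rejectable_states spec_within]) (use isize_powers in simp)
  show "spec (prior_sum_prog I A) (2 * isize) (\<lambda>s. s = mass (captive I T))" if "A = captive I T" for A
    using spec_prior_sum captive_subset rejectable_states that by blast
qed (use isize_powers in auto)

lemma spec_nbrs_mass: "spec (nbrs_mass_prog I T) (6 * isize ^ 2) (\<lambda>s. s = mass (set_nbrs I T))"
  unfolding nbrs_mass_prog_def
proof (rule spec_ensuring, rule spec_bind_le)
  have "{\<theta>\<in>states I. \<theta> \<in> set_nbrs I T} = set_nbrs I T" using set_nbrs_subset by blast
  moreover have "spec (filter_prog (states I) (touches_prog I T)) (4 * isize ^ 2)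
      (\<lambda>A. A = {\<theta>\<in>states I. \<theta> \<in> set_nbrs I T})"
    by (rule spec_filter_states[OF order_refl spec_touches]) (use isize_powers in simp)
  ultimately show "spec (filter_prog (states I) (touches_prog I T)) (4 * isize ^ 2) (\<lambda>A. A = set_nbrs I T)"
    by simp
  show "spec (prior_sum_prog I A) (2 * isize) (\<lambda>s. s = mass (set_nbrs I T))" if "A = set_nbrs I T" for A
    using spec_prior_sum set_nbrs_subset that by blast
qed (use isize_powers in auto)

lemma spec_load:
  assumes "A \<subseteq> states I"
  shows "spec (load_prog I A \<sigma> \<phi>) (2 * isize) (\<lambda>s. s = (\<Sum>\<theta>\<in>signal_nbrs I \<sigma> \<inter> A. \<phi> (\<theta>, \<sigma>)))"
proof -
  have fin: "finite A" using assms finite_states finite_subset by blast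
  have eq: "load_prog I A \<sigma> \<phi> =
      foreach A (\<lambda>\<theta> s. eval (s + (if (\<theta>, \<sigma>) \<in> edges I then \<phi> (\<theta>, \<sigma>) else 0))) 0"
    unfolding load_prog_def by (intro arg_cong2[where f = "foreach A"] ext) auto
  have nbrs: "signal_nbrs I \<sigma> \<inter> A = {\<theta>\<in>A. (\<theta>, \<sigma>) \<in> edges I}" by (auto simp: signal_nbrs_def)
  show ?thesis
    unfolding eq nbrs sum.inter_filter[OF fin]
    by (rule spec_time_mono[OF spec_fold_prog[OF fin]]) (use card_states_le[OF assms] in simp)
qed

lemma spec_rload: "spec (load_prog I (rejectable I) \<sigma> \<phi>) (2 * isize) (\<lambda>s. s = rload \<phi> \<sigma>)"
  unfolding rload_def by (rule spec_load[OF rejectable_states])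

lemma spec_utility: "spec (utility_prog I \<phi>) (6 * isize ^ 2) (\<lambda>u. u = utility I \<phi>)"
  unfolding utility_prog_def
proof (rule spec_ensuring)
  let ?al = "\<lambda>\<sigma>. \<Sum>\<theta>\<in>signal_nbrs I \<sigma> \<inter> acceptable I. \<phi> (\<theta>, \<sigma>)"
  \<comment> \<open>The contribution of one signal, zero if it is rejected. It turns the sum over
    accept signals into one over all signals, which is what the loop accumulates.\<close>
  let ?g = "\<lambda>\<sigma>. if accept_signal I \<phi> \<sigma> then \<Sum>\<theta>\<in>signal_nbrs I \<sigma>. \<phi> (\<theta>, \<sigma>) else 0"
  have step: "spec (prog_bind (load_prog I (acceptable I) \<sigma> \<phi>) (\<lambda>a.
      prog_bind (load_prog I (rejectable I) \<sigma> \<phi>) (\<lambda>r. eval (if a \<ge> r then u + (a + r) else u))))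
      (4 * isize + 1) (\<lambda>u'. u' = u + ?g \<sigma>)" for \<sigma> u
  proof (rule spec_bind_le[OF spec_load, where t' = "2 * isize + 1"], goal_cases)
    case (2 al)
    have "rload \<phi> \<sigma> \<le> al \<longleftrightarrow> accept_signal I \<phi> \<sigma>"
      and "(\<Sum>\<theta>\<in>signal_nbrs I \<sigma>. \<phi> (\<theta>, \<sigma>)) = al + rload \<phi> \<sigma>"
      unfolding 2 by (simp_all only: accept_signal_iff signal_load aload_eq)
    then show ?case by (intro spec_bind[OF spec_rload] spec_eval[where t = 1]) auto
  qed (auto simp: states_def)
  have "spec (foreach (signals I) (\<lambda>\<sigma> u. prog_bind (load_prog I (acceptable I) \<sigma> \<phi>) (\<lambda>a.
      prog_bind (load_prog I (rejectable I) \<sigma> \<phi>) (\<lambda>r. eval (if a \<ge> r then u + (a + r) else u)))) 0)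
      (card (signals I) * (4 * isize + 1 + 1)) (\<lambda>u. u = (\<Sum>\<sigma>\<in>signals I. ?g \<sigma>))"
  proof (rule spec_foreach[OF finite_signals, where Inv = "\<lambda>V u. u = (\<Sum>\<sigma>\<in>V. ?g \<sigma>)"])
    fix V \<sigma> u assume V: "V \<subseteq> signals I" "\<sigma> \<in> signals I - V" and u: "u = (\<Sum>\<sigma>\<in>V. ?g \<sigma>)"
    have "finite V" using V finite_signals finite_subset by blast
    then have "(\<Sum>\<sigma>\<in>insert \<sigma> V. ?g \<sigma>) = u + ?g \<sigma>" using V u by (simp add: add.commute)
    then show "spec (prog_bind (load_prog I (acceptable I) \<sigma> \<phi>) (\<lambda>a.
        prog_bind (load_prog I (rejectable I) \<sigma> \<phi>) (\<lambda>r. eval (if a \<ge> r then u + (a + r) else u))))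
        (4 * isize + 1) (\<lambda>u. u = (\<Sum>\<sigma>\<in>insert \<sigma> V. ?g \<sigma>))"
      using step[of \<sigma> u] by simp
  qed simp
  then show "spec (foreach (signals I) (\<lambda>\<sigma> u. prog_bind (load_prog I (acceptable I) \<sigma> \<phi>) (\<lambda>a.
      prog_bind (load_prog I (rejectable I) \<sigma> \<phi>) (\<lambda>r. eval (if a \<ge> r then u + (a + r) else u)))) 0)
      (6 * isize ^ 2) (\<lambda>u. u = utility I \<phi>)"
  proof (rule spec_mono)
    show "card (signals I) * (4 * isize + 1 + 1) \<le> 6 * isize ^ 2"
      using isize_powers by (intro loop_le2 card_signals_le) auto
  qed (simp add: utility_def sum.inter_filter[OF finite_signals])
qed

text \<open>The loop starts from \<open>undefined\<close>, so afterwards the entries are known to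
  vanish only at pairs of a state and a signal. Later assumptions about zero entries are restricted
  accordingly.\<close>

lemma spec_zero: "spec (zero_prog I) (3 * isize) (\<lambda>\<phi>. \<forall>\<theta>\<in>states I. \<forall>\<sigma>\<in>signals I. \<phi> (\<theta>, \<sigma>) = 0)"
  unfolding zero_prog_def
proof (rule spec_time_mono[OF spec_foreach[OF finite_states,
        where Inv = "\<lambda>V \<phi>. \<forall>\<theta>\<in>V. \<forall>\<sigma>\<in>signals I. \<phi> (\<theta>, \<sigma>) = 0"]])
  fix V \<theta> and \<phi> :: "('s, 'g) scheme" assume \<phi>: "\<forall>\<theta>\<in>V. \<forall>\<sigma>\<in>signals I. \<phi> (\<theta>, \<sigma>) = 0"
  let ?Inv = "\<lambda>W \<phi>. (\<forall>\<theta>\<in>V. \<forall>\<sigma>\<in>signals I. \<phi> (\<theta>, \<sigma>) = 0) \<and> (\<forall>\<sigma>\<in>W. \<phi> (\<theta>, \<sigma>) = 0)"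
  have "spec (foreach (signals I) (\<lambda>\<sigma> \<phi>. eval (\<phi>((\<theta>, \<sigma>) := 0))) \<phi>) (card (signals I) * (1 + 1))
      (?Inv (signals I))"
    by (rule spec_foreach[OF finite_signals, where Inv = ?Inv]) (auto simp: \<phi> intro!: spec_eval)
  then show "spec (foreach (signals I) (\<lambda>\<sigma> \<phi>. eval (\<phi>((\<theta>, \<sigma>) := 0))) \<phi>) (card (signals I) * 2)
      (\<lambda>\<phi>. \<forall>\<theta>\<in>insert \<theta> V. \<forall>\<sigma>\<in>signals I. \<phi> (\<theta>, \<sigma>) = 0)"
    by (rule spec_mono) auto
next
  show "card (states I) * (card (signals I) * 2 + 1) \<le> 3 * isize"
    using card_states_le[of "states I"] by (simp add: isize_def algebra_simps)
qed simp

lemma row_cong: "(\<And>\<sigma>. \<sigma> \<in> state_nbrs I \<theta> \<Longrightarrow> \<phi> (\<theta>, \<sigma>) = \<psi> (\<theta>, \<sigma>)) \<Longrightarrow> row \<phi> \<theta> \<longleftrightarrow> row \<psi> \<theta>"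
  by (auto simp: row_def intro: sum.cong)

lemma spec_spread:
  assumes "\<theta> \<in> states I"
  shows "spec (spread_prog I \<theta> \<phi>) (8 * isize) (adds \<theta> (state_nbrs I \<theta>) (prior I \<theta>) \<phi>)"
  unfolding spread_prog_def
proof (rule spec_bind_le[OF spec_filter_signals[OF order_refl]])
  fix X assume "X = {\<sigma>\<in>signals I. (\<theta>, \<sigma>) \<in> edges I}"
  then have X: "X = state_nbrs I \<theta>" using edgesD by (auto simp: state_nbrs_def)
  show "spec (split_prog \<theta> X (prior I \<theta>) \<phi>) (5 * isize) (adds \<theta> (state_nbrs I \<theta>) (prior I \<theta>) \<phi>)"
    unfolding X
    using spec_split[OF finite_state_nbrs state_nbrs_nonempty[OF assms] prior_nonneg[OF assms]]
    by (rule spec_time_mono) (use card_signals_le[OF state_nbrs_subset, of \<theta>] isize_powers in simp)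
qed simp

text \<open>Each state is treated once, and its row is still zero at that time, so adding its prior
  completes the row. The second conjunct protects the states treated by other loops.\<close>

lemma spec_spread_all:
  assumes D: "D \<subseteq> states I" and zero: "\<And>\<theta> \<sigma>. \<theta> \<in> D \<Longrightarrow> \<sigma> \<in> signals I \<Longrightarrow> \<phi> (\<theta>, \<sigma>) = 0"
  shows "spec (foreach D (spread_prog I) \<phi>) (9 * isize ^ 2)
     (\<lambda>\<phi>'. (\<forall>\<theta>\<in>D. row \<phi>' \<theta>) \<and> (\<forall>\<theta> \<sigma>. \<theta> \<notin> D \<longrightarrow> \<phi>' (\<theta>, \<sigma>) = \<phi> (\<theta>, \<sigma>)))"
proof (rule spec_time_mono)
  have fin: "finite D" using D finite_states finite_subset by blast
  let ?Inv = "\<lambda>V \<phi>'. (\<forall>\<theta>\<in>V. row \<phi>' \<theta>) \<and> (\<forall>\<theta> \<sigma>. \<theta> \<notin> V \<longrightarrow> \<phi>' (\<theta>, \<sigma>) = \<phi> (\<theta>, \<sigma>))"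
  show "spec (foreach D (spread_prog I) \<phi>) (card D * (8 * isize + 1)) (?Inv D)"
  proof (rule spec_foreach[OF fin, where Inv = ?Inv])
    fix V \<theta> \<psi> assume V: "V \<subseteq> D" "\<theta> \<in> D - V" and inv: "?Inv V \<psi>"
    have "\<theta> \<in> states I" using V D by blast
    then show "spec (spread_prog I \<theta> \<psi>) (8 * isize) (?Inv (insert \<theta> V))"
    proof (rule spec_mono[OF spec_spread order_refl])
      fix \<psi>' assume adds: "adds \<theta> (state_nbrs I \<theta>) (prior I \<theta>) \<psi> \<psi>'"
      have z: "\<psi> (\<theta>, \<sigma>) = 0" if "\<sigma> \<in> state_nbrs I \<theta>" for \<sigma>
        using that inv V zero state_nbrs_subset by fastforce
      have "row \<psi>' \<theta>" using adds z by (force simp: row_def adds_def)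
      moreover have "row \<psi>' \<theta>'" if "\<theta>' \<in> V" for \<theta>'
      proof -
        have "\<theta>' \<noteq> \<theta>" using that V by auto
        then have "row \<psi>' \<theta>' \<longleftrightarrow> row \<psi> \<theta>'" using adds by (intro row_cong) (simp add: adds_def)
        then show ?thesis using inv that by simp
      qed
      ultimately show "?Inv (insert \<theta> V) \<psi>'" using inv adds by (auto simp: adds_def)
    qed
  qed simp
  show "card D * (8 * isize + 1) \<le> 9 * isize ^ 2"
    using isize_powers by (intro loop_le2 card_states_le[OF D]) auto
qed

lemma spec_arbitrary_scheme: "spec (arbitrary_scheme_prog I) (12 * isize ^ 2) (signaling_scheme I)"
  unfolding arbitrary_scheme_prog_def
  by (rule spec_ensuring, rule spec_bind_le[OF spec_zero])
    (rule spec_mono[OF spec_spread_all[OF order_refl] order_refl],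
      use isize_powers in \<open>auto simp: signaling_scheme_iff\<close>)

section \<open>The greedy procedure\<close>

text \<open>The threshold in the test of the algorithm. It caps the utility of every scheme
  consistent with \<open>T\<close> by \<open>consistent_utility_le\<close>, and the greedy procedure
  attains it.\<close>

definition bound :: "'g set \<Rightarrow> real" where
  "bound T = min (2 * prior I a) (mass (set_nbrs I T))"

lemma rload_cong:
  assumes "\<And>\<theta>. \<theta> \<noteq> a \<Longrightarrow> \<phi> (\<theta>, \<sigma>) = \<psi> (\<theta>, \<sigma>)"
  shows "rload \<phi> \<sigma> = rload \<psi> \<sigma>"
  unfolding rload_def
proof (intro sum.cong refl assms)
  show "\<theta> \<noteq> a" if "\<theta> \<in> signal_nbrs I \<sigma> \<inter> rejectable I" for \<theta>
    using that a_not_rejectable by auto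
qed

lemma captive_subset_set_nbrs: "captive I T \<subseteq> set_nbrs I T"
proof
  fix \<theta> assume \<theta>: "\<theta> \<in> captive I T"
  then obtain \<sigma> where "\<sigma> \<in> state_nbrs I \<theta>"
    using state_nbrs_nonempty captive_subset rejectable_states by blast
  then have "\<sigma> \<in> T" "\<theta> \<in> signal_nbrs I \<sigma>" using \<theta> by (auto simp: captive_def mem_nbrs_iff)
  then show "\<theta> \<in> set_nbrs I T" by (auto simp: set_nbrs_def)
qed

text \<open>The neighborhood consists of \<open>a\<close>, the captive states and the rejectable
  states with signals both inside and outside \<open>T\<close>. Nonemptiness of \<open>T\<close> is
  what brings in \<open>a\<close>.\<close>

lemma mass_set_nbrs:
  assumes T: "T \<subseteq> state_nbrs I a" "T \<noteq> {}"
  shows "mass (set_nbrs I T) =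
    prior I a + (mass (captive I T) + mass {\<theta>\<in>rejectable I. \<theta> \<in> set_nbrs I T \<and> \<not> state_nbrs I \<theta> \<subseteq> T})"
proof -
  let ?B = "{\<theta>\<in>rejectable I. \<theta> \<in> set_nbrs I T \<and> \<not> state_nbrs I \<theta> \<subseteq> T}"
  have "a \<in> set_nbrs I T" using T by (auto simp: set_nbrs_def mem_nbrs_iff[symmetric])
  moreover have "set_nbrs I T \<subseteq> insert a (rejectable I)" by (metis set_nbrs_subset states_eq)
  ultimately have eq: "set_nbrs I T = insert a (captive I T \<union> ?B)"
    using captive_subset_set_nbrs[of T] unfolding captive_def by blast
  have "a \<notin> captive I T \<union> ?B" using a_not_rejectable by (auto simp: captive_def)
  then have "mass (insert a (captive I T \<union> ?B)) = prior I a + mass (captive I T \<union> ?B)"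
    using finite_captive finite_rejectable by (intro sum.insert) auto
  also have "mass (captive I T \<union> ?B) = mass (captive I T) + mass ?B"
    using finite_rejectable by (intro sum.union_disjoint finite_captive) (auto simp: captive_def)
  finally show ?thesis by (subst eq)
qed

text \<open>The part of the greedy analysis that is independent of the program. The masses of the
  acceptable and the rejectable states on \<open>T\<close> add up to \<open>bound T\<close>, which
  no consistent scheme exceeds; hence optimality follows from the value alone.\<close>

lemma greedy_optimal:
  assumes T: "T \<subseteq> state_nbrs I a"
    and rows: "\<And>\<theta>. \<theta> \<in> rejectable I \<Longrightarrow> row \<phi> \<theta>"
    and cover: "\<And>\<sigma>. \<sigma> \<in> T \<Longrightarrow> rload \<phi> \<sigma> \<le> \<phi> (a, \<sigma>)"
    and unused: "\<And>\<sigma>. \<sigma> \<in> signals I - T \<Longrightarrow> \<phi> (a, \<sigma>) = 0"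
    and total: "(\<Sum>\<sigma>\<in>T. \<phi> (a, \<sigma>)) = prior I a"
    and load: "prior I a + (\<Sum>\<sigma>\<in>T. rload \<phi> \<sigma>) = bound T"
  shows "optimal_consistent_scheme I T \<phi> \<and> utility I \<phi> = bound T"
proof -
  have sub: "T \<subseteq> signals I" using T state_nbrs_subset by blast
  have nonneg: "0 \<le> \<phi> (\<theta>, \<sigma>)" if "\<theta> \<in> rejectable I" "\<theta> \<in> signal_nbrs I \<sigma>" for \<theta> \<sigma>
    using rows that by (auto simp: row_def mem_nbrs_iff)
  then have rload: "0 \<le> rload \<phi> \<sigma>" for \<sigma> unfolding rload_def by (auto intro: sum_nonneg)
  have "row \<phi> a"
    unfolding row_def
  proof
    show "\<forall>\<sigma>\<in>state_nbrs I a. 0 \<le> \<phi> (a, \<sigma>)"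
    proof
      fix \<sigma> assume "\<sigma> \<in> state_nbrs I a"
      then show "0 \<le> \<phi> (a, \<sigma>)"
        using cover[of \<sigma>] unused[of \<sigma>] rload[of \<sigma>] state_nbrs_subset[of a] by (cases "\<sigma> \<in> T") auto
    qed
    have "(\<Sum>\<sigma>\<in>state_nbrs I a. \<phi> (a, \<sigma>)) = (\<Sum>\<sigma>\<in>T. \<phi> (a, \<sigma>))"
      using T unused state_nbrs_subset by (intro sum.mono_neutral_right finite_state_nbrs) auto
    then show "(\<Sum>\<sigma>\<in>state_nbrs I a. \<phi> (a, \<sigma>)) = prior I a" using total by simp
  qed
  then have scheme: "signaling_scheme I \<phi>"
    using rows by (auto simp: signaling_scheme_iff states_eq)
  have acc: "accept_signal I \<phi> \<sigma>" if "\<sigma> \<in> T" for \<sigma>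
    using that T cover by (auto simp: accept_signal_iff)
  \<comment> \<open>Outside \<open>T\<close> the acceptable state sends nothing, so acceptance is
    possible only as a tie at zero. This is the exception that \<open>consistent_scheme\<close>
    allows.\<close>
  have zero: "\<forall>\<theta>\<in>signal_nbrs I \<sigma>. \<phi> (\<theta>, \<sigma>) = 0" if \<sigma>: "\<sigma> \<in> signals I - T" "accept_signal I \<phi> \<sigma>" for \<sigma>
  proof -
    have "rload \<phi> \<sigma> \<le> 0" using \<sigma> unused[OF \<sigma>(1)] by (simp add: accept_signal_iff split: if_splits)
    then have "rload \<phi> \<sigma> = 0" using rload[of \<sigma>] by linarith
    then have "\<forall>\<theta>\<in>signal_nbrs I \<sigma> \<inter> rejectable I. \<phi> (\<theta>, \<sigma>) = 0"
      unfolding rload_def using nonneg finite_signal_nbrs by (subst (asm) sum_nonneg_eq_0_iff) auto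
    then show ?thesis using unused[OF \<sigma>(1)] signal_nbrs_subset[of \<sigma>] states_eq by fastforce
  qed
  have cons: "consistent_scheme I T \<phi>"
    using scheme acc zero by (auto simp: consistent_scheme_def)
  have "utility I \<phi> = (\<Sum>\<sigma>\<in>T. \<Sum>\<theta>\<in>signal_nbrs I \<sigma>. \<phi> (\<theta>, \<sigma>))"
    by (rule utility_eq[OF sub acc]) (use zero in auto)
  also have "\<dots> = (\<Sum>\<sigma>\<in>T. \<phi> (a, \<sigma>) + rload \<phi> \<sigma>)"
    using T by (intro sum.cong refl) (auto simp: signal_load)
  also have "\<dots> = bound T" using total load by (simp add: sum.distrib)
  finally have "utility I \<phi> = bound T" .
  then show ?thesis
    using cons consistent_utility_le[OF _ sub]
    by (simp add: optimal_consistent_scheme_def bound_def)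
qed

text \<open>The two distributions touch disjoint sets of signals that together make up the
  neighborhood, so the second one preserves the amount \<open>x\<close> placed on \<open>T\<close>
  and completes the row.\<close>

lemma adds_twice:
  assumes X: "X = state_nbrs I \<theta> \<inter> T" and Y: "Y = state_nbrs I \<theta> - T"
    and zero: "\<And>\<sigma>. \<sigma> \<in> state_nbrs I \<theta> \<Longrightarrow> \<phi> (\<theta>, \<sigma>) = 0"
    and adds: "adds \<theta> X x \<phi> \<phi>'" "adds \<theta> Y (prior I \<theta> - x) \<phi>' \<phi>''"
  shows "row \<phi>'' \<theta>" "(\<Sum>\<sigma>\<in>state_nbrs I \<theta> \<inter> T. \<phi>'' (\<theta>, \<sigma>)) = x"
    and "\<And>\<theta>' \<sigma>. \<theta>' \<noteq> \<theta> \<Longrightarrow> \<phi>'' (\<theta>', \<sigma>) = \<phi> (\<theta>', \<sigma>)"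
proof -
  have disj: "state_nbrs I \<theta> = X \<union> Y" "X \<inter> Y = {}" using X Y by auto
  have fin: "finite X" "finite Y" using X Y finite_state_nbrs by auto
  have onX: "\<phi>'' (\<theta>, \<sigma>) = \<phi>' (\<theta>, \<sigma>)" if "\<sigma> \<in> X" for \<sigma> using that disj adds(2) by (auto simp: adds_def)
  have onY: "\<phi>' (\<theta>, \<sigma>) = \<phi> (\<theta>, \<sigma>)" if "\<sigma> \<in> Y" for \<sigma> using that disj adds(1) by (auto simp: adds_def)
  have sumX: "(\<Sum>\<sigma>\<in>X. \<phi>'' (\<theta>, \<sigma>)) = x"
    using adds(1) zero disj onX by (simp add: adds_def)
  then show "(\<Sum>\<sigma>\<in>state_nbrs I \<theta> \<inter> T. \<phi>'' (\<theta>, \<sigma>)) = x" by (simp add: X)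
  have "(\<Sum>\<sigma>\<in>Y. \<phi>'' (\<theta>, \<sigma>)) = prior I \<theta> - x"
    using adds(2) zero disj onY by (simp add: adds_def)
  moreover have "0 \<le> \<phi>'' (\<theta>, \<sigma>)" if \<sigma>: "\<sigma> \<in> state_nbrs I \<theta>" for \<sigma>
  proof (cases "\<sigma> \<in> X")
    case True
    then show ?thesis using adds(1) onX zero[OF \<sigma>] by (auto simp: adds_def)
  next
    case False
    then have "\<sigma> \<in> Y" using \<sigma> disj by auto
    then show ?thesis using adds(2) onY zero[OF \<sigma>] by (auto simp: adds_def)
  qed
  ultimately show "row \<phi>'' \<theta>"
    using sumX fin disj by (simp add: row_def sum.union_disjoint)
  show "\<phi>'' (\<theta>', \<sigma>) = \<phi> (\<theta>', \<sigma>)" if "\<theta>' \<noteq> \<theta>" for \<theta>' \<sigma>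
    using that adds by (simp add: adds_def)
qed

text \<open>Every state of \<open>B\<close> may choose how much it sends into \<open>T\<close>, and
  yet the total must be exact. The invariant \<open>need \<le> rest\<close> says that the untreated
  states can still supply what is missing.\<close>

lemma spec_fill:
  assumes B: "B \<subseteq> rejectable I" "\<And>\<theta>. \<theta> \<in> B \<Longrightarrow> \<theta> \<in> set_nbrs I T \<and> \<not> state_nbrs I \<theta> \<subseteq> T"
    and zero: "\<And>\<theta> \<sigma>. \<theta> \<in> B \<Longrightarrow> \<sigma> \<in> signals I \<Longrightarrow> \<phi>\<^sub>0 (\<theta>, \<sigma>) = 0"
    and need: "0 \<le> need\<^sub>0" "need\<^sub>0 \<le> mass B"
  shows "spec (foreach B (\<lambda>\<theta> (\<phi>, need, rest). do {
         X \<leftarrow> filter_prog (signals I) (\<lambda>\<sigma>. eval ((\<theta>, \<sigma>) \<in> edges I \<and> \<sigma> \<in> T));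
         Y \<leftarrow> filter_prog (signals I) (\<lambda>\<sigma>. eval ((\<theta>, \<sigma>) \<in> edges I \<and> \<sigma> \<notin> T));
         rest \<leftarrow> eval (rest - prior I \<theta>);
         x \<leftarrow> pick {max 0 (need - rest)..min need (prior I \<theta>)};
         \<phi> \<leftarrow> split_prog \<theta> X x \<phi>;
         \<phi> \<leftarrow> split_prog \<theta> Y (prior I \<theta> - x) \<phi>;
         eval (\<phi>, need - x, rest)
       }) (\<phi>\<^sub>0, need\<^sub>0, mass B)) (20 * isize ^ 2)
     (\<lambda>(\<phi>, _). (\<forall>\<theta>\<in>B. row \<phi> \<theta>) \<and> (\<forall>\<theta> \<sigma>. \<theta> \<notin> B \<longrightarrow> \<phi> (\<theta>, \<sigma>) = \<phi>\<^sub>0 (\<theta>, \<sigma>)) \<and>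
        (\<Sum>\<theta>\<in>B. \<Sum>\<sigma>\<in>state_nbrs I \<theta> \<inter> T. \<phi> (\<theta>, \<sigma>)) = need\<^sub>0)"
    (is "spec (foreach B ?f ?init) _ _")
proof -
  have fin: "finite B" using B finite_rejectable finite_subset by blast
  have Bs: "B \<subseteq> states I" using B rejectable_states by blast
  define Inv where "Inv = (\<lambda>V (\<phi>, need, rest).
      (\<forall>\<theta>\<in>V. row \<phi> \<theta>) \<and> (\<forall>\<theta> \<sigma>. \<theta> \<notin> V \<longrightarrow> \<phi> (\<theta>, \<sigma>) = \<phi>\<^sub>0 (\<theta>, \<sigma>)) \<and>
      rest = mass (B - V) \<and> 0 \<le> need \<and> need \<le> rest \<and>
      need + (\<Sum>\<theta>\<in>V. \<Sum>\<sigma>\<in>state_nbrs I \<theta> \<inter> T. \<phi> (\<theta>, \<sigma>)) = need\<^sub>0)"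
  have "spec (foreach B ?f ?init) (card B * (16 * isize + 3 + 1)) (Inv B)"
  proof (rule spec_foreach[OF fin])
    show "Inv {} ?init" using need by (simp add: Inv_def)
  next
    fix V \<theta> p assume V: "V \<subseteq> B" "\<theta> \<in> B - V" and invp: "Inv V p"
    obtain \<phi> need rest where p: "p = (\<phi>, need, rest)" using prod_cases3 by blast
    have inv: "\<forall>\<theta>\<in>V. row \<phi> \<theta>" "\<forall>\<theta> \<sigma>. \<theta> \<notin> V \<longrightarrow> \<phi> (\<theta>, \<sigma>) = \<phi>\<^sub>0 (\<theta>, \<sigma>)"
      "rest = mass (B - V)" "0 \<le> need" "need \<le> rest"
      "need + (\<Sum>\<theta>\<in>V. \<Sum>\<sigma>\<in>state_nbrs I \<theta> \<inter> T. \<phi> (\<theta>, \<sigma>)) = need\<^sub>0"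
      using invp by (auto simp: Inv_def p)
    have \<theta>: "\<theta> \<in> states I" "\<theta> \<in> set_nbrs I T" "\<not> state_nbrs I \<theta> \<subseteq> T" using V B Bs by auto
    have ne: "state_nbrs I \<theta> \<inter> T \<noteq> {}" "state_nbrs I \<theta> - T \<noteq> {}"
      using \<theta> by (auto simp: set_nbrs_def mem_nbrs_iff)
    have zero': "\<phi> (\<theta>, \<sigma>) = 0" if "\<sigma> \<in> state_nbrs I \<theta>" for \<sigma>
      using that inv(2) V zero state_nbrs_subset by fastforce
    have finV: "finite V" using V fin finite_subset by blast
    have "B - V = insert \<theta> (B - insert \<theta> V)" using V by auto
    then have "rest = prior I \<theta> + mass (B - insert \<theta> V)"
      using inv(3) fin by (metis DiffE Diff_insert_absorb finite_Diff insertI1 insert_Diff_single sum.insert)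
    then have rest': "rest - prior I \<theta> = mass (B - insert \<theta> V)" by simp
    have rest'_nonneg: "0 \<le> rest - prior I \<theta>"
      unfolding rest' using Bs prior_nonneg by (intro sum_nonneg) auto
    \<comment> \<open>The lower end keeps the new need within the new rest, the upper end keeps both
      the need and the remaining prior nonnegative. The interval is nonempty because
      \<open>need\<close> is at most the new rest plus the prior of \<open>\<theta>\<close>.\<close>
    have choice: "{max 0 (need - (rest - prior I \<theta>))..min need (prior I \<theta>)} \<noteq> {}"
      using inv(4,5) rest'_nonneg prior_nonneg[OF \<theta>(1)] by simp
    have step: "Inv (insert \<theta> V) (\<phi>'', need - x, rest - prior I \<theta>)"
      if x: "x \<in> {max 0 (need - (rest - prior I \<theta>))..min need (prior I \<theta>)}"
        and adds: "adds \<theta> (state_nbrs I \<theta> \<inter> T) x \<phi> \<phi>'"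
          "adds \<theta> (state_nbrs I \<theta> - T) (prior I \<theta> - x) \<phi>' \<phi>''" for x \<phi>' \<phi>''
    proof -
      note * = adds_twice[OF refl refl zero' adds]
      have "row \<phi>'' \<theta>' \<longleftrightarrow> row \<phi> \<theta>'" if "\<theta>' \<in> V" for \<theta>'
        using that V by (intro row_cong *(3)) auto
      moreover have "(\<Sum>\<theta>'\<in>V. \<Sum>\<sigma>\<in>state_nbrs I \<theta>' \<inter> T. \<phi>'' (\<theta>', \<sigma>)) =
          (\<Sum>\<theta>'\<in>V. \<Sum>\<sigma>\<in>state_nbrs I \<theta>' \<inter> T. \<phi> (\<theta>', \<sigma>))"
        using V by (intro sum.cong refl *(3)) auto
      ultimately show ?thesis
        using inv *(1,2,3) x V finV rest' by (auto simp: Inv_def)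
    qed
    have sets: "{\<sigma>\<in>signals I. (\<theta>, \<sigma>) \<in> edges I \<and> \<sigma> \<in> T} = state_nbrs I \<theta> \<inter> T"
      "{\<sigma>\<in>signals I. (\<theta>, \<sigma>) \<in> edges I \<and> \<sigma> \<notin> T} = state_nbrs I \<theta> - T"
      using edgesD by (auto simp: state_nbrs_def)
    have split: "spec (split_prog \<theta> X y \<psi>) (5 * isize) (adds \<theta> X y \<psi>)"
      if "X \<subseteq> state_nbrs I \<theta>" "X \<noteq> {}" "0 \<le> y" for X y \<psi>
    proof (rule spec_time_mono[OF spec_split])
      show "card X * 3 + 2 \<le> 5 * isize"
        using card_signals_le[OF order_trans[OF that(1) state_nbrs_subset]] isize_powers by simp
    qed (use that finite_state_nbrs finite_subset in auto)
    have "spec (?f \<theta> (\<phi>, need, rest))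
        (3 * isize + (3 * isize + (1 + (1 + (5 * isize + (5 * isize + 1)))))) (Inv (insert \<theta> V))"
      unfolding prod.case
      apply (rule spec_bind[OF spec_filter_signals[OF order_refl]])
      apply (rule spec_bind[OF spec_filter_signals[OF order_refl]])
      apply (simp only: sets)
      apply (rule spec_bind[where P = "\<lambda>r. r = rest - prior I \<theta>"])
       apply (simp add: spec_eval)
      apply (simp only:)
      apply (rule spec_bind[OF spec_pick[OF choice]])
      apply (rule spec_bind[OF split])
         apply (use ne in auto)[3]
      apply (rule spec_bind[OF split])
         apply (use ne in auto)[3]
      apply (rule spec_eval)
       apply (rule step)
         apply assumption+
      apply simp
      done
    then show "spec (?f \<theta> p) (16 * isize + 3) (Inv (insert \<theta> V))"
      unfolding p by (rule spec_time_mono) simp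
  qed
  then show ?thesis
  proof (rule spec_mono)
    show "card B * (16 * isize + 3 + 1) \<le> 20 * isize ^ 2"
      using isize_powers by (intro loop_le2 card_states_le[OF Bs]) auto
  \<comment> \<open>At the end \<open>rest\<close> is the mass of the empty set, so
    \<open>need\<close> is squeezed to 0 and the amount placed on \<open>T\<close> is exactly the
    initial need.\<close>
  qed (auto simp: Inv_def)
qed

text \<open>Only the row of the acceptable state is written, and rejectable loads do not depend on
  it. All loads can therefore be measured in the initial scheme, even though the program reads the
  current one.\<close>

lemma spec_match:
  assumes T: "T \<subseteq> signals I"
  shows "spec (foreach T (\<lambda>\<sigma> (\<phi>, r). do {
         l \<leftarrow> load_prog I (rejectable I) \<sigma> \<phi>;
         eval (\<phi>((a, \<sigma>) := l), r - l)
       }) (\<phi>\<^sub>0, r\<^sub>0)) (4 * isize ^ 2)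
     (\<lambda>(\<phi>, r). (\<forall>\<theta> \<sigma>. \<theta> \<noteq> a \<or> \<sigma> \<notin> T \<longrightarrow> \<phi> (\<theta>, \<sigma>) = \<phi>\<^sub>0 (\<theta>, \<sigma>)) \<and>
        (\<forall>\<sigma>\<in>T. \<phi> (a, \<sigma>) = rload \<phi>\<^sub>0 \<sigma>) \<and> r = r\<^sub>0 - (\<Sum>\<sigma>\<in>T. rload \<phi>\<^sub>0 \<sigma>))"
    (is "spec (foreach T ?f ?init) _ _")
proof -
  have fin: "finite T" using T finite_signals finite_subset by blast
  define Inv where "Inv = (\<lambda>V (\<phi>, r). (\<forall>\<theta> \<sigma>. \<theta> \<noteq> a \<or> \<sigma> \<notin> V \<longrightarrow> \<phi> (\<theta>, \<sigma>) = \<phi>\<^sub>0 (\<theta>, \<sigma>)) \<and>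
        (\<forall>\<sigma>\<in>V. \<phi> (a, \<sigma>) = rload \<phi>\<^sub>0 \<sigma>) \<and> r = r\<^sub>0 - (\<Sum>\<sigma>\<in>V. rload \<phi>\<^sub>0 \<sigma>))"
  have "spec (foreach T ?f ?init) (card T * (2 * isize + 1 + 1)) (Inv T)"
  proof (rule spec_foreach[OF fin])
    show "Inv {} ?init" by (simp add: Inv_def)
  next
    fix V \<sigma> p assume V: "V \<subseteq> T" "\<sigma> \<in> T - V" and invp: "Inv V p"
    obtain \<phi> r where p: "p = (\<phi>, r)" by force
    have "rload \<phi> \<sigma> = rload \<phi>\<^sub>0 \<sigma>" using invp by (intro rload_cong) (auto simp: Inv_def p)
    moreover have "finite V" using V fin finite_subset by blast
    ultimately have "Inv (insert \<sigma> V) (\<phi>((a, \<sigma>) := rload \<phi> \<sigma>), r - rload \<phi> \<sigma>)"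
      using invp V by (auto simp: Inv_def p)
    then show "spec (?f \<sigma> p) (2 * isize + 1) (Inv (insert \<sigma> V))"
      unfolding p prod.case by (intro spec_bind[OF spec_rload] spec_eval) auto
  qed
  then show ?thesis
  proof (rule spec_mono)
    show "card T * (2 * isize + 1 + 1) \<le> 4 * isize ^ 2"
      using isize_powers by (intro loop_le2 card_signals_le[OF T]) auto
  qed (simp add: Inv_def)
qed

text \<open>On \<open>T\<close>, the captive states \<open>A\<close> put all of their mass, the
  states of \<open>B\<close> exactly \<open>need\<close>, and the states of \<open>C\<close>
  nothing. The rejectable load on \<open>T\<close> is thus the minimum of \<open>prior I a\<close>
  and \<open>mass A + mass B\<close>, and adding \<open>prior I a\<close> gives
  \<open>bound T\<close>. The bound on the captive mass makes \<open>need\<close>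
  nonnegative.\<close>

lemma spec_greedy:
  assumes T: "T \<subseteq> state_nbrs I a" "T \<noteq> {}" and cap: "mass (captive I T) \<le> prior I a"
  shows "spec (greedy_prog I T) (70 * isize ^ 2)
    (\<lambda>\<phi>. optimal_consistent_scheme I T \<phi> \<and> utility I \<phi> = bound T)"
proof -
  have Ts: "T \<subseteq> signals I" using T state_nbrs_subset by blast
  have finT: "finite T" using Ts finite_signals finite_subset by blast
  define A where "A = captive I T"
  define B where "B = {\<theta>\<in>rejectable I. \<theta> \<in> set_nbrs I T \<and> \<not> state_nbrs I \<theta> \<subseteq> T}"
  define C where "C = {\<theta>\<in>rejectable I. \<theta> \<notin> set_nbrs I T}"
  define need where "need = min (prior I a) (mass A + mass B) - mass A"
  have subs: "A \<subseteq> states I" "B \<subseteq> states I" "C \<subseteq> states I" "B \<subseteq> rejectable I"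
    using rejectable_states by (auto simp: A_def B_def C_def captive_def)
  have A_nbrs: "A \<subseteq> set_nbrs I T"
    unfolding A_def by (rule captive_subset_set_nbrs)
  have parts: "rejectable I = A \<union> B \<union> C" "A \<inter> B = {}" "(A \<union> B) \<inter> C = {}" "a \<notin> A \<union> B \<union> C"
    using A_nbrs a_not_rejectable by (auto simp: A_def B_def C_def captive_def)
  have fin: "finite A" "finite B" "finite C" using parts(1) finite_rejectable by auto
  have massB: "0 \<le> mass B" using subs prior_nonneg by (intro sum_nonneg) auto
  have need: "0 \<le> need" "need \<le> mass B" using cap massB by (auto simp: need_def A_def)
  have nbrs: "mass (set_nbrs I T) = prior I a + (mass A + mass B)"
    unfolding A_def B_def by (rule mass_set_nbrs[OF T])
  have load: "(\<Sum>\<sigma>\<in>T. rload \<phi> \<sigma>) = min (prior I a) (mass A + mass B)"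
    if rows: "\<forall>\<theta>\<in>A. row \<phi> \<theta>" and B: "(\<Sum>\<theta>\<in>B. \<Sum>\<sigma>\<in>state_nbrs I \<theta> \<inter> T. \<phi> (\<theta>, \<sigma>)) = need" for \<phi>
  proof -
    have A: "(\<Sum>\<theta>\<in>A. \<Sum>\<sigma>\<in>state_nbrs I \<theta> \<inter> T. \<phi> (\<theta>, \<sigma>)) = mass A"
    proof (intro sum.cong refl)
      fix \<theta> assume "\<theta> \<in> A"
      then have "row \<phi> \<theta>" "state_nbrs I \<theta> \<inter> T = state_nbrs I \<theta>"
        using rows by (auto simp: A_def captive_def)
      then show "(\<Sum>\<sigma>\<in>state_nbrs I \<theta> \<inter> T. \<phi> (\<theta>, \<sigma>)) = prior I \<theta>" by (simp add: row_def)
    qed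
    have "state_nbrs I \<theta> \<inter> T = {}" if "\<theta> \<in> C" for \<theta>
      using that by (auto simp: C_def set_nbrs_def mem_nbrs_iff)
    then have C: "(\<Sum>\<theta>\<in>C. \<Sum>\<sigma>\<in>state_nbrs I \<theta> \<inter> T. \<phi> (\<theta>, \<sigma>)) = 0" by simp
    show ?thesis
      unfolding sum_rload[OF finT] parts(1)
      using A B C parts fin by (simp add: sum.union_disjoint need_def)
  qed
  have filterA: "spec (filter_prog (rejectable I) (within_prog I T)) (4 * isize ^ 2) (\<lambda>X. X = A)"
    unfolding A_def captive_def
    by (rule spec_filter_states[OF rejectable_states spec_within]) (use isize_powers in simp)
  have filterB: "spec (filter_prog (rejectable I) (\<lambda>\<theta>. do {
      t \<leftarrow> touches_prog I T \<theta>; w \<leftarrow> within_prog I T \<theta>; eval (t \<and> \<not> w) })) (7 * isize ^ 2) (\<lambda>X. X = B)"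
    unfolding B_def
    by (rule spec_filter_states[OF rejectable_states, where t = "2 * isize + (2 * isize + 1)"],
        rule spec_bind[OF spec_touches], rule spec_bind[OF spec_within], rule spec_eval)
      (use isize_powers in auto)
  have filterC: "spec (filter_prog (rejectable I) (\<lambda>\<theta>. do {
      t \<leftarrow> touches_prog I T \<theta>; eval (\<not> t) })) (5 * isize ^ 2) (\<lambda>X. X = C)"
    unfolding C_def
    by (rule spec_filter_states[OF rejectable_states, where t = "2 * isize + 1"],
        rule spec_bind[OF spec_touches], rule spec_eval)
      (use isize_powers in auto)
  have split: "spec (split_prog a T r \<phi>) (5 * isize) (adds a T r \<phi>)" if "0 \<le> r" for r \<phi>
    by (rule spec_time_mono[OF spec_split[OF finT T(2) that]])
      (use card_signals_le[OF Ts] isize_powers in simp)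
  have "spec (greedy_prog I T) (3 * isize + (4 * isize ^ 2 + (7 * isize ^ 2 + (5 * isize ^ 2 +
      (2 * isize + (2 * isize + (9 * isize ^ 2 + (20 * isize ^ 2 + (4 * isize ^ 2 + (5 * isize + 9 * isize ^ 2))))))))))
    (\<lambda>\<phi>. optimal_consistent_scheme I T \<phi> \<and> utility I \<phi> = bound T)"
    unfolding greedy_prog_def
  proof (rule spec_bind[OF spec_zero], rule spec_bind[OF filterA], rule spec_bind[OF filterB],
      rule spec_bind[OF filterC], simp only:, rule spec_bind[OF spec_prior_sum[OF subs(1)]],
      rule spec_bind[OF spec_prior_sum[OF subs(2)]], simp only: need_def[symmetric],
      rule spec_bind[OF spec_spread_all[OF subs(1)]])
    fix \<phi>0 :: "('s, 'g) scheme" assume \<phi>0: "\<forall>\<theta>\<in>states I. \<forall>\<sigma>\<in>signals I. \<phi>0 (\<theta>, \<sigma>) = 0"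
    show "\<phi>0 (\<theta>, \<sigma>) = 0" if "\<theta> \<in> A" "\<sigma> \<in> signals I" for \<theta> \<sigma> using \<phi>0 that subs by blast
    fix \<phi>1 assume \<phi>1: "(\<forall>\<theta>\<in>A. row \<phi>1 \<theta>) \<and> (\<forall>\<theta> \<sigma>. \<theta> \<notin> A \<longrightarrow> \<phi>1 (\<theta>, \<sigma>) = \<phi>0 (\<theta>, \<sigma>))"
    show "spec (do {
         (\<phi>, need, rest) \<leftarrow> foreach B (\<lambda>\<theta> (\<phi>, need, rest). do {
             X \<leftarrow> filter_prog (signals I) (\<lambda>\<sigma>. eval ((\<theta>, \<sigma>) \<in> edges I \<and> \<sigma> \<in> T));
             Y \<leftarrow> filter_prog (signals I) (\<lambda>\<sigma>. eval ((\<theta>, \<sigma>) \<in> edges I \<and> \<sigma> \<notin> T));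
             rest \<leftarrow> eval (rest - prior I \<theta>);
             x \<leftarrow> pick {max 0 (need - rest)..min need (prior I \<theta>)};
             \<phi> \<leftarrow> split_prog \<theta> X x \<phi>;
             \<phi> \<leftarrow> split_prog \<theta> Y (prior I \<theta> - x) \<phi>;
             eval (\<phi>, need - x, rest)
           }) (\<phi>1, need, mass B);
         (\<phi>, r) \<leftarrow> foreach T (\<lambda>\<sigma> (\<phi>, r). do {
             l \<leftarrow> load_prog I (rejectable I) \<sigma> \<phi>;
             eval (\<phi>((a, \<sigma>) := l), r - l)
           }) (\<phi>, prior I a);
         \<phi> \<leftarrow> split_prog a T r \<phi>;
         foreach C (spread_prog I) \<phi>
       }) (20 * isize ^ 2 + (4 * isize ^ 2 + (5 * isize + 9 * isize ^ 2)))
       (\<lambda>\<phi>. optimal_consistent_scheme I T \<phi> \<and> utility I \<phi> = bound T)"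
    proof (rule spec_bind[OF spec_fill[OF subs(4) _ _ need]], goal_cases)
      case 1
      then show ?case by (simp add: B_def)
    next
      case (2 \<theta> \<sigma>)
      then have "\<theta> \<notin> A" "\<theta> \<in> states I" using parts subs by auto
      then show ?case using 2 \<phi>0 \<phi>1 by simp
    next
      case (3 p)
      obtain \<phi>2 z where p: "p = (\<phi>2, z)" using surj_pair[of p] by blast
      have \<phi>2: "\<forall>\<theta>\<in>B. row \<phi>2 \<theta>" "\<forall>\<theta> \<sigma>. \<theta> \<notin> B \<longrightarrow> \<phi>2 (\<theta>, \<sigma>) = \<phi>1 (\<theta>, \<sigma>)"
        "(\<Sum>\<theta>\<in>B. \<Sum>\<sigma>\<in>state_nbrs I \<theta> \<inter> T. \<phi>2 (\<theta>, \<sigma>)) = need"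
        using 3 by (auto simp: p)
      have rowsA: "\<forall>\<theta>\<in>A. row \<phi>2 \<theta>"
      proof
        fix \<theta> assume "\<theta> \<in> A"
        moreover from this have "\<theta> \<notin> B" using parts by auto
        ultimately show "row \<phi>2 \<theta>" using \<phi>1 \<phi>2(2) row_cong[of \<theta> \<phi>2 \<phi>1] by simp
      qed
      note load2 = load[OF rowsA \<phi>2(3)]
      have zero2: "\<phi>2 (\<theta>, \<sigma>) = 0" if "\<theta> \<in> insert a C" "\<sigma> \<in> signals I" for \<theta> \<sigma>
      proof -
        have "\<theta> \<notin> A" "\<theta> \<notin> B" "\<theta> \<in> states I" using that parts subs a_states by auto
        then show ?thesis using \<phi>0 \<phi>1 \<phi>2(2) that by simp
      qed
      obtain w1 w2 where z: "z = (w1, w2)" by force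
      show ?case
        unfolding p z prod.case
      proof (rule spec_bind[OF spec_match[OF Ts]])
        fix p' assume p': "case p' of (\<phi>, r) \<Rightarrow>
          (\<forall>\<theta> \<sigma>. \<theta> \<noteq> a \<or> \<sigma> \<notin> T \<longrightarrow> \<phi> (\<theta>, \<sigma>) = \<phi>2 (\<theta>, \<sigma>)) \<and>
          (\<forall>\<sigma>\<in>T. \<phi> (a, \<sigma>) = rload \<phi>2 \<sigma>) \<and> r = prior I a - (\<Sum>\<sigma>\<in>T. rload \<phi>2 \<sigma>)"
        obtain \<phi>3 r where p'_eq: "p' = (\<phi>3, r)" by force
        have \<phi>3: "\<forall>\<theta> \<sigma>. \<theta> \<noteq> a \<or> \<sigma> \<notin> T \<longrightarrow> \<phi>3 (\<theta>, \<sigma>) = \<phi>2 (\<theta>, \<sigma>)"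
          "\<forall>\<sigma>\<in>T. \<phi>3 (a, \<sigma>) = rload \<phi>2 \<sigma>" "r = prior I a - (\<Sum>\<sigma>\<in>T. rload \<phi>2 \<sigma>)"
          using p' by (auto simp: p'_eq)
        \<comment> \<open>The rejectable load on \<open>T\<close> is at most
          \<open>prior I a\<close>, so matching it cannot exhaust the acceptable state. Spreading
          the rest over \<open>T\<close> only raises its entries and keeps every signal of
          \<open>T\<close> accepted.\<close>
        have r: "0 \<le> r" using \<phi>3(3) load2 by simp
        show "spec (case p' of (\<phi>, r) \<Rightarrow> prog_bind (split_prog a T r \<phi>) (foreach C (spread_prog I)))
          (5 * isize + 9 * isize ^ 2) (\<lambda>\<phi>. optimal_consistent_scheme I T \<phi> \<and> utility I \<phi> = bound T)"
          unfolding p'_eq prod.case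
        proof (rule spec_bind[OF split[OF r]], rule spec_mono[OF spec_spread_all[OF subs(3)] order_refl])
          fix \<phi>4 assume adds: "adds a T r \<phi>3 \<phi>4"
          have \<phi>4: "\<phi>4 (\<theta>, \<sigma>) = \<phi>2 (\<theta>, \<sigma>)" if "\<theta> \<noteq> a \<or> \<sigma> \<notin> T" for \<theta> \<sigma>
            using that adds \<phi>3(1) by (simp add: adds_def)
          show "\<phi>4 (\<theta>, \<sigma>) = 0" if "\<theta> \<in> C" "\<sigma> \<in> signals I" for \<theta> \<sigma>
          proof -
            have "\<theta> \<noteq> a" using that parts by auto
            then show ?thesis using \<phi>4 zero2 that by simp
          qed
          fix \<phi>5 assume \<phi>5: "(\<forall>\<theta>\<in>C. row \<phi>5 \<theta>) \<and> (\<forall>\<theta> \<sigma>. \<theta> \<notin> C \<longrightarrow> \<phi>5 (\<theta>, \<sigma>) = \<phi>4 (\<theta>, \<sigma>))"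
          have same: "\<phi>5 (\<theta>, \<sigma>) = \<phi>2 (\<theta>, \<sigma>)" if "\<theta> \<in> A \<union> B" for \<theta> \<sigma>
          proof -
            have "\<theta> \<notin> C" "\<theta> \<noteq> a" using that parts by auto
            then show ?thesis using \<phi>4 \<phi>5 by simp
          qed
          have same_a: "\<phi>5 (a, \<sigma>) = \<phi>4 (a, \<sigma>)" for \<sigma> using \<phi>5 parts(4) by simp
          \<comment> \<open>The last loop treats states without signals in \<open>T\<close>, so the
            loads matched before remain valid.\<close>
          have rload: "rload \<phi>5 \<sigma> = rload \<phi>2 \<sigma>" if "\<sigma> \<in> T" for \<sigma>
            unfolding rload_def
          proof (intro sum.cong refl)
            fix \<theta> assume "\<theta> \<in> signal_nbrs I \<sigma> \<inter> rejectable I"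
            moreover from this have "\<theta> \<notin> C" using that by (auto simp: C_def set_nbrs_def)
            ultimately have "\<theta> \<in> A \<union> B" using parts(1) by blast
            then show "\<phi>5 (\<theta>, \<sigma>) = \<phi>2 (\<theta>, \<sigma>)" by (rule same)
          qed
          show "optimal_consistent_scheme I T \<phi>5 \<and> utility I \<phi>5 = bound T"
          proof (rule greedy_optimal[OF T(1)])
            fix \<theta> assume \<theta>: "\<theta> \<in> rejectable I"
            show "row \<phi>5 \<theta>"
            proof (cases "\<theta> \<in> C")
              case False
              then have AB: "\<theta> \<in> A \<union> B" using \<theta> parts(1) by auto
              then have "row \<phi>5 \<theta> \<longleftrightarrow> row \<phi>2 \<theta>" using same by (intro row_cong) auto
              then show ?thesis using AB rowsA \<phi>2(1) by auto
            qed (use \<phi>5 in simp)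
          next
            fix \<sigma> assume \<sigma>: "\<sigma> \<in> T"
            then show "rload \<phi>5 \<sigma> \<le> \<phi>5 (a, \<sigma>)"
              using adds \<phi>3(2) by (auto simp: rload same_a adds_def)
          next
            fix \<sigma> assume "\<sigma> \<in> signals I - T"
            then show "\<phi>5 (a, \<sigma>) = 0" using \<phi>4 zero2 by (simp add: same_a)
          next
            show "(\<Sum>\<sigma>\<in>T. \<phi>5 (a, \<sigma>)) = prior I a"
              using adds \<phi>3(2,3) by (simp add: same_a adds_def)
          next
            show "prior I a + (\<Sum>\<sigma>\<in>T. rload \<phi>5 \<sigma>) = bound T"
              using load2 nbrs by (simp add: rload bound_def)
          qed
        qed
      qed
    qed
  qed
  then show ?thesis by (rule spec_time_mono) (use isize_powers in simp)
qed

section \<open>The main loop\<close>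

lemma utility_nonneg:
  assumes "signaling_scheme I \<phi>"
  shows "0 \<le> utility I \<phi>"
  unfolding utility_def
proof (intro sum_nonneg)
  fix \<sigma> \<theta> assume "\<theta> \<in> signal_nbrs I \<sigma>"
  then show "0 \<le> \<phi> (\<theta>, \<sigma>)"
    using assms signal_nbrs_subset[of \<sigma>] by (auto simp: signaling_scheme_iff row_def mem_nbrs_iff)
qed

lemma bound_mono: "T \<subseteq> U \<Longrightarrow> bound T \<le> bound U"
  unfolding bound_def by (intro min.mono mass_mono set_nbrs_mono set_nbrs_subset) auto

text \<open>The bound is promised only when the acceptable state can send all of \<open>T\<close>.
  Otherwise a missing adjacency comes from a heavy signal, no consistent scheme exists, and keeping
  the old scheme is justified.\<close>

lemma spec_improve:
  assumes T: "T \<subseteq> heavy I \<epsilon> \<union> state_nbrs I a" and \<epsilon>: "0 < \<epsilon>"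
    and cap: "mass (captive I T) \<le> prior I a" and \<phi>: "signaling_scheme I \<phi>"
  shows "spec (improve_prog I T \<phi>) (84 * isize ^ 2) (\<lambda>\<phi>'. signaling_scheme I \<phi>' \<and>
    utility I \<phi> \<le> utility I \<phi>' \<and> (T \<subseteq> state_nbrs I a \<longrightarrow> bound T \<le> utility I \<phi>'))"
    (is "spec _ _ ?Q")
proof -
  have Ts: "T \<subseteq> signals I" using T state_nbrs_subset by (auto simp: heavy_def)
  have test: "spec (foreach (signals I) (\<lambda>\<sigma> t. eval (t \<and> (\<sigma> \<in> T \<longrightarrow> (a, \<sigma>) \<in> edges I))) True)
      (2 * isize) (\<lambda>t. t \<longleftrightarrow> T \<subseteq> state_nbrs I a)"
    by (rule spec_mono[OF spec_all_prog[OF finite_signals]])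
      (use card_signals_le[of "signals I"] Ts in \<open>auto simp: state_nbrs_def\<close>)
  have branch: "spec (if t then greedy_prog I T ensuring optimal_consistent_scheme I T
      else ret \<phi> ensuring (\<lambda>_. \<nexists>\<psi>. consistent_scheme I T \<psi>)) (70 * isize ^ 2) ?Q"
    if t: "t \<longleftrightarrow> T \<subseteq> state_nbrs I a" and less: "utility I \<phi> < bound T" for t
  proof (cases t)
    case True
    \<comment> \<open>For empty \<open>T\<close> the bound is not positive, while utilities are
      nonnegative, so the test fails. Thus the greedy procedure is called with nonempty sets
      only.\<close>
    have "T \<noteq> {}" using less utility_nonneg[OF \<phi>] by (auto simp: bound_def set_nbrs_def)
    then have "spec (greedy_prog I T ensuring optimal_consistent_scheme I T) (70 * isize ^ 2)
        (\<lambda>\<phi>. optimal_consistent_scheme I T \<phi> \<and> utility I \<phi> = bound T)"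
      using t True cap by (intro spec_ensuring[OF spec_greedy]) auto
    then show ?thesis
      using True less
      by (auto elim!: spec_mono simp: optimal_consistent_scheme_def consistent_scheme_def)
  next
    case False
    then obtain \<sigma> where "\<sigma> \<in> T" "\<sigma> \<in> heavy I \<epsilon>" "\<sigma> \<notin> state_nbrs I a" using t T by blast
    then have "\<nexists>\<psi>. consistent_scheme I T \<psi>" using no_consistent_scheme \<epsilon> by blast
    then show ?thesis using False t \<phi> by (auto intro!: spec_ensuring spec_ret)
  qed
  show ?thesis
    unfolding improve_prog_def
  proof (rule spec_bind_le[OF spec_utility], rule spec_bind[OF spec_nbrs_mass])
    fix u v assume u: "u = utility I \<phi>" and v: "v = mass (set_nbrs I T)"
    have cond: "u < min (2 * prior I a) v \<longleftrightarrow> utility I \<phi> < bound T"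
      by (simp add: u v bound_def)
    show "spec (if u < min (2 * prior I a) v then do {
         t \<leftarrow> foreach (signals I) (\<lambda>\<sigma> t. eval (t \<and> (\<sigma> \<in> T \<longrightarrow> (a, \<sigma>) \<in> edges I))) True;
         if t then greedy_prog I T ensuring optimal_consistent_scheme I T
         else ret \<phi> ensuring (\<lambda>_. \<nexists>\<psi>. consistent_scheme I T \<psi>)
       } else ret \<phi>) (2 * isize + 70 * isize ^ 2) ?Q"
      unfolding cond
    proof (cases "utility I \<phi> < bound T", goal_cases)
      case 1
      show ?case using spec_bind[OF test branch[OF _ 1]] 1 by simp
    next
      case 2
      then show ?case using \<phi> by (simp add: spec_ret)
    qed
  qed (use isize_powers in simp)
qed

text \<open>What the iteration for \<open>S\<close> contributes; \<open>U\<close> stands for the accepted signals adjacent to \<open>\<theta>\<^sub>a\<close>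
  of a competing scheme.\<close>

definition covers :: "real \<Rightarrow> 'g set \<Rightarrow> ('s, 'g) scheme \<Rightarrow> bool" where
  "covers \<epsilon> S \<phi> \<longleftrightarrow> (\<forall>U. U \<subseteq> state_nbrs I a \<and> U \<inter> heavy I \<epsilon> = S \<and> mass (captive I U) \<le> prior I a \<longrightarrow>
     bound U \<le> (1 + \<epsilon>) * utility I \<phi>)"

text \<open>What one subset has contributed survives the iterations for all later subsets, since the
  utility never decreases.\<close>

lemma covers_mono:
  assumes "covers \<epsilon> S \<phi>" "utility I \<phi> \<le> utility I \<psi>" "0 < \<epsilon>"
  shows "covers \<epsilon> S \<psi>"
proof -
  have "(1 + \<epsilon>) * utility I \<phi> \<le> (1 + \<epsilon>) * utility I \<psi>"
    using assms(2,3) by (intro mult_left_mono) auto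
  then have "bound U \<le> (1 + \<epsilon>) * utility I \<psi>" if "bound U \<le> (1 + \<epsilon>) * utility I \<phi>" for U
    using that by linarith
  then show ?thesis using assms(1) unfolding covers_def by blast
qed

text \<open>The loop ends either by the break, with a set that contains every relevant
  \<open>U\<close>, or by an overflow, where the set before the last insertion is good enough
  against every \<open>U\<close>.\<close>

lemma spec_extend:
  assumes \<epsilon>: "0 < \<epsilon>" "\<epsilon> \<le> 1" and S: "S \<subseteq> heavy I \<epsilon>"
    and L: "L = (signals I - heavy I \<epsilon>) \<inter> state_nbrs I a" and \<phi>: "signaling_scheme I \<phi>\<^sub>0"
  shows "spec (extend_prog I L S \<phi>\<^sub>0) (300 * isize ^ 3)
    (\<lambda>\<phi>. signaling_scheme I \<phi> \<and> utility I \<phi>\<^sub>0 \<le> utility I \<phi> \<and> covers \<epsilon> S \<phi>)"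
    (is "spec _ _ ?Q")
proof -
  have Ls: "L \<subseteq> signals I" "L \<subseteq> state_nbrs I a" using L by auto
  have finL: "finite L" using Ls finite_signals finite_subset by blast
  define reached where
    "reached T \<phi> \<longleftrightarrow> (T \<subseteq> state_nbrs I a \<longrightarrow> bound T \<le> utility I \<phi>)" for T \<phi>
  \<comment> \<open>The set \<open>T'\<close> from before the last insertion has to be remembered,
    because overflow is noticed only at the next test; by then \<open>T'\<close> has been used for
    an improvement. The alternative \<open>T = S\<close> is the situation before any
    insertion.\<close>
  define Inv where "Inv = (\<lambda>(T, \<phi>, brk). S \<subseteq> T \<and> T \<subseteq> S \<union> L \<and> signaling_scheme I \<phi> \<and>
    utility I \<phi>\<^sub>0 \<le> utility I \<phi> \<and>
    (if brk then L \<subseteq> T \<and> reached T \<phi>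
     else T = S \<or> (\<exists>\<sigma> T'. \<sigma> \<in> L \<and> T' \<subseteq> S \<union> L \<and> T = insert \<sigma> T' \<and> reached T' \<phi>)))"
  define G where "G = (\<lambda>(T, \<phi> :: ('s, 'g) scheme, brk). \<not> brk \<and> mass (captive I T) \<le> prior I a)"
  \<comment> \<open>The summand 1 pays for the iteration that merely sets the break flag without
    adding a signal.\<close>
  define \<mu> where "\<mu> = (\<lambda>(T, \<phi> :: ('s, 'g) scheme, brk). if brk then 0 else 1 + card (L - T))"
  have exit: "covers \<epsilon> S \<phi>"
    if inv: "Inv (T, \<phi>, brk)" and stop: "\<not> G (T, \<phi>, brk)" for T \<phi> brk
    unfolding covers_def
  proof (intro allI impI, elim conjE)
    fix U assume U: "U \<subseteq> state_nbrs I a" "U \<inter> heavy I \<epsilon> = S" "mass (captive I U) \<le> prior I a"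
    have nonneg: "0 \<le> utility I \<phi>" using inv utility_nonneg by (simp add: Inv_def)
    \<comment> \<open>The existence of \<open>U\<close> forces \<open>S\<close> to be adjacent to
      the acceptable state, which discharges the premise of \<open>reached\<close>.\<close>
    have SL: "S \<union> L \<subseteq> state_nbrs I a" using U Ls by auto
    show "bound U \<le> (1 + \<epsilon>) * utility I \<phi>"
    proof (cases brk)
      case True
      have "U \<subseteq> S \<union> L" using U state_nbrs_subset by (auto simp: L)
      then have "U \<subseteq> T" using inv True by (auto simp: Inv_def)
      moreover have "bound T \<le> utility I \<phi>"
        using inv True SL by (auto simp: Inv_def reached_def)
      ultimately have "bound U \<le> utility I \<phi>" using bound_mono order_trans by blast
      also have "\<dots> \<le> (1 + \<epsilon>) * utility I \<phi>" using nonneg \<epsilon> by (simp add: distrib_right)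
      finally show ?thesis .
    next
      case False
      then have over: "prior I a < mass (captive I T)" using stop by (auto simp: G_def)
      \<comment> \<open>Being part of the feasible set \<open>U\<close>, the set \<open>S\<close> is
        feasible too. Hence the overflow was caused by an insertion, and the invariant supplies the
        set before it.\<close>
      have "mass (captive I S) \<le> mass (captive I U)" using U by (intro captive_mass_mono) auto
      then have "T \<noteq> S" using over U by auto
      then obtain \<sigma> T' where T': "\<sigma> \<in> L" "T' \<subseteq> S \<union> L" "T = insert \<sigma> T'" "reached T' \<phi>"
        using inv False by (auto simp: Inv_def)
      have light: "mass (captive I {\<sigma>}) < \<epsilon> * prior I a"
        using T'(1) by (auto simp: L heavy_def)
      have T'a: "T' \<subseteq> state_nbrs I a" using T' SL by auto
      have "bound U \<le> 2 * prior I a" by (simp add: bound_def)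
      also have "\<dots> \<le> (1 + \<epsilon>) * bound T'"
        unfolding bound_def using overflow_bound[OF T'a _ light \<epsilon>] over T'(3) by simp
      also have "\<dots> \<le> (1 + \<epsilon>) * utility I \<phi>"
        using T'(4) T'a \<epsilon> by (intro mult_left_mono) (auto simp: reached_def)
      finally show ?thesis .
    qed
  qed
  have loop: "spec (while_loop
       (\<lambda>(T, \<phi>, brk). if brk then ret False
          else do { r \<leftarrow> captive_mass_prog I T; eval (r \<le> prior I a) })
       (\<lambda>(T, \<phi>, brk). do {
          \<phi> \<leftarrow> improve_prog I T \<phi>;
          R \<leftarrow> filter_prog L (\<lambda>\<sigma>. eval (\<sigma> \<notin> T));
          if R = {} then ret (T, \<phi>, True)
          else do { \<sigma> \<leftarrow> pick R; eval (insert \<sigma> T, \<phi>, False) }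
        })
       (S, \<phi>\<^sub>0, False)) ((\<mu> (S, \<phi>\<^sub>0, False) + 1) * (1 + (6 * isize ^ 2 + 1) + (84 * isize ^ 2 + (3 * isize + 2))))
       (\<lambda>(T, \<phi>, brk). ?Q \<phi>)"
  proof (rule spec_while[where Inv = Inv and G = G])
    show "Inv (S, \<phi>\<^sub>0, False)" using \<phi> by (simp add: Inv_def)
  next
    fix p assume inv: "Inv p"
    obtain T \<phi> brk where p: "p = (T, \<phi>, brk)" using prod_cases3 by blast
    have Q: "?Q \<phi>" if "\<not> G p" using exit that inv by (simp add: p Inv_def)
    show "spec (case p of (T, \<phi>, brk) \<Rightarrow> if brk then ret False
          else do { r \<leftarrow> captive_mass_prog I T; eval (r \<le> prior I a) }) (6 * isize ^ 2 + 1)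
        (\<lambda>r. if r then G p else case p of (T, \<phi>, brk) \<Rightarrow> ?Q \<phi>)"
    proof (cases brk)
      case True
      then have "\<not> G p" by (simp add: p G_def)
      then show ?thesis using Q True by (simp add: p spec_ret)
    next
      case False
      have "spec (do { r \<leftarrow> captive_mass_prog I T; eval (r \<le> prior I a) }) (6 * isize ^ 2 + 1)
        (\<lambda>r. if r then G p else ?Q \<phi>)"
        by (intro spec_bind[OF spec_captive_mass] spec_eval) (use Q False in \<open>auto simp: p G_def\<close>)
      then show ?thesis using False by (simp only: p prod.case if_False)
    qed
  next
    fix p assume inv: "Inv p" and "G p"
    obtain T \<phi> brk where p: "p = (T, \<phi>, brk)" using prod_cases3 by blast
    have brk: "\<not> brk" and cap: "mass (captive I T) \<le> prior I a" using \<open>G p\<close> by (auto simp: p G_def)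
    have T: "S \<subseteq> T" "T \<subseteq> S \<union> L" and \<phi>: "signaling_scheme I \<phi>" "utility I \<phi>\<^sub>0 \<le> utility I \<phi>"
      using inv by (auto simp: p Inv_def)
    have Th: "T \<subseteq> heavy I \<epsilon> \<union> state_nbrs I a" using T S Ls by auto
    let ?P = "\<lambda>q. Inv q \<and> \<mu> q < \<mu> p"
    have "spec (if R = {} then ret (T, \<psi>, True) else do { \<sigma> \<leftarrow> pick R; eval (insert \<sigma> T, \<psi>, False) })
        2 ?P" if \<psi>: "signaling_scheme I \<psi>" "utility I \<phi> \<le> utility I \<psi>" "reached T \<psi>"
        and R: "R = {\<sigma>\<in>L. \<sigma> \<notin> T}" for R \<psi>
    proof (cases "R = {}")
      case True
      then have "?P (T, \<psi>, True)" using R T \<psi> \<phi> brk by (auto simp: Inv_def \<mu>_def p)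
      then show ?thesis using True by (simp add: spec_ret)
    next
      case False
      have "?P (insert \<sigma> T, \<psi>, False)" if "\<sigma> \<in> R" for \<sigma>
      proof
        show "Inv (insert \<sigma> T, \<psi>, False)" using that R T \<psi> \<phi> by (auto simp: Inv_def)
        have "card (L - insert \<sigma> T) < card (L - T)"
          using that R finL by (intro psubset_card_mono) auto
        then show "\<mu> (insert \<sigma> T, \<psi>, False) < \<mu> p" using brk by (simp add: \<mu>_def p)
      qed
      then have "spec (do { \<sigma> \<leftarrow> pick R; eval (insert \<sigma> T, \<psi>, False) }) 2 ?P"
        by (intro spec_bind_le[OF spec_pick[OF False], where t' = 1] spec_eval) auto
      then show ?thesis using False by simp
    qed
    then show "spec (case p of (T, \<phi>, brk) \<Rightarrow> do {
          \<phi> \<leftarrow> improve_prog I T \<phi>;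
          R \<leftarrow> filter_prog L (\<lambda>\<sigma>. eval (\<sigma> \<notin> T));
          if R = {} then ret (T, \<phi>, True)
          else do { \<sigma> \<leftarrow> pick R; eval (insert \<sigma> T, \<phi>, False) }
        }) (84 * isize ^ 2 + (3 * isize + 2)) ?P"
      unfolding p prod.case
      by (intro spec_bind[OF spec_improve[OF Th \<epsilon>(1) cap \<phi>(1)]] spec_bind[OF spec_filter_signals[OF Ls(1)]])
        (auto simp: reached_def)
  qed
  show ?thesis
    unfolding extend_prog_def
  proof (rule spec_bind_le[OF loop, where t' = 0])
    show "spec (case p of (T, \<phi>, brk) \<Rightarrow> ret \<phi>) 0 ?Q" if "case p of (T, \<phi>, brk) \<Rightarrow> ?Q \<phi>" for p
      using that by (auto simp: spec_ret split: prod.splits)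
    have "card (L - S) \<le> isize" using Ls by (intro card_signals_le) auto
    then have "\<mu> (S, \<phi>\<^sub>0, False) + 1 \<le> 3 * isize" using isize_powers by (simp add: \<mu>_def)
    \<comment> \<open>The coefficients add up to 97. With at most \<open>3 * isize\<close>
      iterations this gives 291, rounded up to 300.\<close>
    moreover have "1 + (6 * isize ^ 2 + 1) + (84 * isize ^ 2 + (3 * isize + 2)) \<le> 97 * isize ^ 2"
      using isize_powers by linarith
    ultimately have "(\<mu> (S, \<phi>\<^sub>0, False) + 1) *
        (1 + (6 * isize ^ 2 + 1) + (84 * isize ^ 2 + (3 * isize + 2))) \<le> (3 * isize) * (97 * isize ^ 2)"
      by (rule mult_le_mono)
    then show "(\<mu> (S, \<phi>\<^sub>0, False) + 1) *
        (1 + (6 * isize ^ 2 + 1) + (84 * isize ^ 2 + (3 * isize + 2))) + 0 \<le> 300 * isize ^ 3"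
      by (simp add: power3_eq_cube power2_eq_square)
  qed
qed

section \<open>Computing the heavy signals and enumerating their small subsets\<close>

lemma spec_heavy: "spec (heavy_prog I \<epsilon>) (12 * isize ^ 3) (\<lambda>H. H = heavy I \<epsilon>)"
  unfolding heavy_prog_def
proof (rule spec_ensuring, rule spec_time_mono)
  have test: "spec (do {
         T \<leftarrow> filter_prog (signals I) (\<lambda>\<sigma>'. eval (\<sigma>' = \<sigma>));
         r \<leftarrow> captive_mass_prog I T;
         eval (r \<ge> \<epsilon> * prior I a) }) (3 * isize + (6 * isize ^ 2 + 1))
      (\<lambda>t. t \<longleftrightarrow> mass (captive I {\<sigma>}) \<ge> \<epsilon> * prior I a)" if \<sigma>: "\<sigma> \<in> signals I" for \<sigma>
  proof (rule spec_bind[OF spec_filter_signals[OF order_refl]])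
    fix T assume "T = {\<sigma>'\<in>signals I. \<sigma>' = \<sigma>}"
    then have "T = {\<sigma>}" using \<sigma> by auto
    then show "spec (do { r \<leftarrow> captive_mass_prog I T; eval (r \<ge> \<epsilon> * prior I a) }) (6 * isize ^ 2 + 1)
        (\<lambda>t. t \<longleftrightarrow> mass (captive I {\<sigma>}) \<ge> \<epsilon> * prior I a)"
      by (intro spec_bind[OF spec_captive_mass] spec_eval) auto
  qed
  show "spec (filter_prog (signals I) (\<lambda>\<sigma>. do {
         T \<leftarrow> filter_prog (signals I) (\<lambda>\<sigma>'. eval (\<sigma>' = \<sigma>));
         r \<leftarrow> captive_mass_prog I T;
         eval (r \<ge> \<epsilon> * prior I a) }))
      (card (signals I) * (3 * isize + (6 * isize ^ 2 + 1) + 2)) (\<lambda>H. H = heavy I \<epsilon>)"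
    unfolding heavy_def by (rule spec_filter[OF finite_signals test])
  show "card (signals I) * (3 * isize + (6 * isize ^ 2 + 1) + 2) \<le> 12 * isize ^ 3"
    using isize_powers by (intro loop_le3 card_signals_le) auto
qed auto

definition small_subsets :: "real \<Rightarrow> 'g set \<Rightarrow> 'g set set" where
  "small_subsets \<epsilon> H = {S. S \<subseteq> H \<and> real (card S) \<le> 1 / \<epsilon>}"

lemma finite_small_subsets: "finite H \<Longrightarrow> finite (small_subsets \<epsilon> H)"
  by (rule finite_subset[of _ "Pow H"]) (auto simp: small_subsets_def)

text \<open>The recursion behind the enumeration: a small subset either avoids
  \<open>\<sigma>\<close> or extends an old one that still has room. The size test can use
  \<open>card S + 1\<close> because \<open>\<sigma>\<close> is not in \<open>V\<close>.\<close>

lemma small_subsets_insert: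
  assumes "finite V" "\<sigma> \<notin> V"
  shows "small_subsets \<epsilon> (insert \<sigma> V) =
    small_subsets \<epsilon> V \<union> insert \<sigma> ` {S \<in> small_subsets \<epsilon> V. real (card S + 1) \<le> 1 / \<epsilon>}"
proof (intro equalityI subsetI)
  fix S assume S: "S \<in> small_subsets \<epsilon> (insert \<sigma> V)"
  show "S \<in> small_subsets \<epsilon> V \<union> insert \<sigma> ` {S \<in> small_subsets \<epsilon> V. real (card S + 1) \<le> 1 / \<epsilon>}"
  proof (cases "\<sigma> \<in> S")
    case True
    have "finite S"
      by (rule finite_subset[of _ "insert \<sigma> V"]) (use S assms in \<open>auto simp: small_subsets_def\<close>)
    then have "card (S - {\<sigma>}) + 1 = card S" using card_Suc_Diff1[OF _ True] by simp
    then have "S - {\<sigma>} \<in> {S \<in> small_subsets \<epsilon> V. real (card S + 1) \<le> 1 / \<epsilon>}"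
      using S by (auto simp: small_subsets_def)
    moreover have "S = insert \<sigma> (S - {\<sigma>})" using True by auto
    ultimately show ?thesis by blast
  qed (use S in \<open>auto simp: small_subsets_def\<close>)
next
  fix S assume "S \<in> small_subsets \<epsilon> V \<union> insert \<sigma> ` {S \<in> small_subsets \<epsilon> V. real (card S + 1) \<le> 1 / \<epsilon>}"
  then consider "S \<in> small_subsets \<epsilon> V"
    | S' where "S' \<in> small_subsets \<epsilon> V" "real (card S' + 1) \<le> 1 / \<epsilon>" "S = insert \<sigma> S'" by auto
  then show "S \<in> small_subsets \<epsilon> (insert \<sigma> V)"
  proof cases
    case 2
    then have "S' \<subseteq> V" by (simp add: small_subsets_def)
    then have "finite S'" "\<sigma> \<notin> S'" using assms finite_subset by auto
    then show ?thesis using 2 by (auto simp: small_subsets_def)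
  qed (auto simp: small_subsets_def)
qed

text \<open>The intermediate lists only grow, so each has at most as many entries as there are small
  subsets of the full \<open>H\<close>. This makes the time proportional to the size of the output.
  The inner loop runs over the old list while extending a copy.\<close>

lemma spec_small_subsets:
  assumes H: "H \<subseteq> signals I" and \<epsilon>: "0 < \<epsilon>"
  shows "spec (small_subsets_prog I \<epsilon> H) (6 * isize ^ 2 * card (small_subsets \<epsilon> H))
    (\<lambda>Ss. distinct Ss \<and> set Ss = (\<lambda>S. (card S, S)) ` small_subsets \<epsilon> H)"
    (is "spec _ (6 * isize ^ 2 * ?N) _")
proof -
  have finH: "finite H" using H finite_signals finite_subset by blast
  let ?pair = "\<lambda>S. (card S, S)"
  let ?body = "\<lambda>\<sigma> (k, S) Ss'. if real (k + 1) \<le> 1 / \<epsilon>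
         then do {
           S' \<leftarrow> filter_prog (signals I) (\<lambda>\<sigma>'. eval (\<sigma>' \<in> S));
           eval ((k + 1, insert \<sigma> S') # Ss')
         } else ret Ss'"
  define Inv where "Inv V Ss \<longleftrightarrow> distinct Ss \<and> set Ss = ?pair ` small_subsets \<epsilon> V" for V Ss
  have step: "spec (foreach_list Ss (?body \<sigma>) Ss) (?N * (3 * isize + 1 + 1)) (Inv (insert \<sigma> V))"
    if V: "V \<subseteq> H" "\<sigma> \<in> H - V" and inv: "Inv V Ss" for V \<sigma> Ss
  proof -
    have finV: "finite V" using V finH finite_subset by blast
    have Ss: "distinct Ss" "set Ss = ?pair ` small_subsets \<epsilon> V" using inv by (auto simp: Inv_def)
    have small: "\<sigma> \<notin> S" "S \<subseteq> signals I" if "(k, S) \<in> set Ss" for k S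
      using that V H by (auto simp: Ss(2) small_subsets_def)
    define new where "new W = {(k + 1, insert \<sigma> S) |k S. (k, S) \<in> W \<and> real (k + 1) \<le> 1 / \<epsilon>}"
      for W :: "(nat \<times> 'g set) set"
    define J where "J W Ss' \<longleftrightarrow> distinct Ss' \<and> set Ss' = set Ss \<union> new W" for W Ss'
    have "spec (foreach (set Ss) (?body \<sigma>) Ss) (card (set Ss) * (3 * isize + 1 + 1)) (J (set Ss))"
    proof (rule spec_foreach)
      show "J {} Ss" using Ss by (simp add: J_def new_def)
    next
      fix W x Ss' assume W: "W \<subseteq> set Ss" "x \<in> set Ss - W" and J: "J W Ss'"
      obtain k S where x: "x = (k, S)" by force
      show "spec (?body \<sigma> x Ss') (3 * isize + 1) (J (insert x W))"
      proof (cases "real (k + 1) \<le> 1 / \<epsilon>")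
        case True
        have S: "{\<sigma>'\<in>signals I. \<sigma>' \<in> S} = S" using small[of k S] W x by auto
        \<comment> \<open>No old subset contains \<open>\<sigma>\<close>; distinctness among the new
          ones follows because inserting \<open>\<sigma>\<close> is injective on sets without
          it.\<close>
        have "(k + 1, insert \<sigma> S) \<notin> set Ss" using small by blast
        moreover have "(k + 1, insert \<sigma> S) \<notin> new W"
        proof
          assume "(k + 1, insert \<sigma> S) \<in> new W"
          then obtain S' where S': "(k, S') \<in> W" "insert \<sigma> S = insert \<sigma> S'"
            by (auto simp: new_def)
          have "\<sigma> \<notin> S" "\<sigma> \<notin> S'" using small[of k S'] small[of k S] S' W x by auto
          then have "S = S'" using S'(2) by (simp add: insert_ident)
          then show False using S' W x by blast
        qed
        moreover have "new (insert x W) = insert (k + 1, insert \<sigma> S) (new W)"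
          using True by (auto simp: new_def x)
        ultimately have "J (insert x W) ((k + 1, insert \<sigma> S) # Ss')"
          using J by (auto simp: J_def)
        then have "spec (do {
           S' \<leftarrow> filter_prog (signals I) (\<lambda>\<sigma>'. eval (\<sigma>' \<in> S));
           eval ((k + 1, insert \<sigma> S') # Ss')
         }) (3 * isize + 1) (J (insert x W))"
          by (intro spec_bind[OF spec_filter_signals[OF order_refl]] spec_eval) (auto simp: S)
        then show ?thesis using True by (simp add: x)
      next
        case False
        then have "new (insert x W) = new W" by (auto simp: new_def x)
        then show ?thesis using False J by (simp add: x J_def spec_ret)
      qed
    qed simp
    moreover have "card (set Ss) \<le> ?N"
    proof -
      have "card (set Ss) = card (small_subsets \<epsilon> V)"
        unfolding Ss(2) by (intro card_image inj_onI) simp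
      also have "\<dots> \<le> ?N"
        using V by (intro card_mono finite_small_subsets[OF finH]) (auto simp: small_subsets_def)
      finally show ?thesis .
    qed
    moreover have "Inv (insert \<sigma> V) Ss'" if "J (set Ss) Ss'" for Ss'
    proof -
      have "new (set Ss) = ?pair ` insert \<sigma> ` {S \<in> small_subsets \<epsilon> V. real (card S + 1) \<le> 1 / \<epsilon>}"
      proof -
        have card: "card (insert \<sigma> S) = card S + 1" if "S \<in> small_subsets \<epsilon> V" for S
        proof -
          have "S \<subseteq> V" using that by (simp add: small_subsets_def)
          then have "finite S" "\<sigma> \<notin> S" using V finite_subset[OF _ finV] by auto
          then show ?thesis by simp
        qed
        have "new (set Ss) = (\<lambda>S. (card S + 1, insert \<sigma> S)) ` {S \<in> small_subsets \<epsilon> V. real (card S + 1) \<le> 1 / \<epsilon>}"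
          unfolding new_def Ss(2) by blast
        also have "\<dots> = (\<lambda>S. ?pair (insert \<sigma> S)) ` {S \<in> small_subsets \<epsilon> V. real (card S + 1) \<le> 1 / \<epsilon>}"
          by (intro image_cong refl) (simp add: card)
        finally show ?thesis by (simp only: image_image)
      qed
      moreover have "\<sigma> \<notin> V" using V by simp
      ultimately show ?thesis
        using that by (simp add: Inv_def J_def Ss(2) small_subsets_insert[OF finV] image_Un)
    qed
    ultimately show ?thesis
      unfolding foreach_list_distinct[OF Ss(1)] using spec_mono[OF _ mult_le_mono1] by blast
  qed
  have "{} \<in> small_subsets \<epsilon> H" using \<epsilon> by (simp add: small_subsets_def)
  \<comment> \<open>The empty set is always enumerated. A positive count allows the additive costs
    of the loops to be absorbed into multiples of it.\<close>
  then have N: "1 \<le> ?N" using finite_small_subsets[OF finH] by (auto simp: Suc_le_eq card_gt_0_iff)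
  have "Inv {} [(0, {})]" using \<epsilon> by (auto simp: Inv_def small_subsets_def)
  then have "spec (foreach H (\<lambda>\<sigma> Ss. foreach_list Ss (?body \<sigma>) Ss) [(0, {})])
      (card H * (?N * (3 * isize + 1 + 1) + 1)) (Inv H)"
    by (intro spec_foreach[OF finH]) (use step in auto)
  moreover have "card H * (?N * (3 * isize + 1 + 1) + 1) \<le> 6 * isize ^ 2 * ?N"
  proof -
    have "3 * isize + 1 + 1 \<le> 5 * isize" using isize_powers by simp
    then have "?N * (3 * isize + 1 + 1) \<le> ?N * (5 * isize)" by (rule mult_le_mono2)
    moreover have "1 \<le> ?N * isize" using N isize_powers by (simp add: Suc_le_eq)
    ultimately have "?N * (3 * isize + 1 + 1) + 1 \<le> ?N * (5 * isize) + ?N * isize" by (rule add_mono)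
    also have "\<dots> = 6 * ?N * isize" by simp
    finally have "?N * (3 * isize + 1 + 1) + 1 \<le> 6 * ?N * isize" .
    from loop_le2[OF card_signals_le[OF H] this] show ?thesis by (simp add: ac_simps)
  qed
  ultimately have "spec (foreach H (\<lambda>\<sigma> Ss. foreach_list Ss (?body \<sigma>) Ss) [(0, {})])
      (6 * isize ^ 2 * ?N) (Inv H)" by (rule spec_time_mono)
  then show ?thesis
    unfolding small_subsets_prog_def Inv_def
    by (rule spec_ensuring) (auto simp: small_subsets_def)
qed

section \<open>Approximation ratio and total running time\<close>

text \<open>The heavy part of the accepted signals of any competitor is among the enumerated
  subsets, so \<open>covers\<close> for that subset bounds this competitor. Arguing per competitor
  avoids having to produce a maximizer.\<close>

lemma opt_le:
  assumes \<phi>: "signaling_scheme I \<phi>" and \<epsilon>: "0 < \<epsilon>"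
    and covers: "\<And>S. S \<in> small_subsets \<epsilon> (heavy I \<epsilon>) \<Longrightarrow> covers \<epsilon> S \<phi>"
  shows "opt I \<le> (1 + \<epsilon>) * utility I \<phi>"
  unfolding opt_def
proof (rule cSup_least)
  show "utility I ` {\<phi>. signaling_scheme I \<phi>} \<noteq> {}" using \<phi> by blast
next
  fix u assume "u \<in> utility I ` {\<phi>. signaling_scheme I \<phi>}"
  then obtain \<psi> where \<psi>: "signaling_scheme I \<psi>" and u: "u = utility I \<psi>" by blast
  obtain U where U: "U \<subseteq> state_nbrs I a" "mass (captive I U) \<le> prior I a" "utility I \<psi> \<le> bound U"
    unfolding bound_def using utility_le_accepted[OF \<psi>] by blast
  have "mass (captive I (U \<inter> heavy I \<epsilon>)) \<le> prior I a"
    using captive_mass_mono[of "U \<inter> heavy I \<epsilon>" U] U(2) by simp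
  then have "real (card (U \<inter> heavy I \<epsilon>)) \<le> 1 / \<epsilon>" by (intro card_heavy_le[OF _ _ \<epsilon>]) auto
  then have "covers \<epsilon> (U \<inter> heavy I \<epsilon>) \<phi>" by (intro covers) (simp add: small_subsets_def)
  then have "bound U \<le> (1 + \<epsilon>) * utility I \<phi>" using U by (auto simp: covers_def)
  then show "u \<le> (1 + \<epsilon>) * utility I \<phi>" using U u by simp
qed

lemma spec_algorithm:
  assumes \<epsilon>: "0 < \<epsilon>" "\<epsilon> \<le> 1"
  shows "spec (algorithm_P I \<epsilon>) (340 * isize ^ 3 * card (small_subsets \<epsilon> (heavy I \<epsilon>)))
    (approx_solution I (1 + \<epsilon>))"
    (is "spec _ (340 * isize ^ 3 * ?N) _")
proof -
  have H: "heavy I \<epsilon> \<subseteq> signals I" by (auto simp: heavy_def)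
  have finH: "finite (heavy I \<epsilon>)" using H finite_signals finite_subset by blast
  define L where "L = (signals I - heavy I \<epsilon>) \<inter> state_nbrs I a"
  have light: "spec (filter_prog (signals I) (\<lambda>\<sigma>. eval (\<sigma> \<notin> heavy I \<epsilon> \<and> (a, \<sigma>) \<in> edges I))
      ensuring (\<lambda>X. X = (signals I - heavy I \<epsilon>) \<inter> state_nbrs I a)) (3 * isize) (\<lambda>X. X = L)"
    by (rule spec_ensuring, rule spec_mono[OF spec_filter_signals[OF order_refl] order_refl])
      (auto simp: L_def state_nbrs_def)
  have main: "spec (foreach_list Ss (\<lambda>(k, S). extend_prog I L S) \<phi>\<^sub>0) (?N * (300 * isize ^ 3 + 1))
      (approx_solution I (1 + \<epsilon>))"
    if \<phi>\<^sub>0: "signaling_scheme I \<phi>\<^sub>0"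
      and Ss: "distinct Ss" "set Ss = (\<lambda>S. (card S, S)) ` small_subsets \<epsilon> (heavy I \<epsilon>)" for \<phi>\<^sub>0 Ss
  proof -
    \<comment> \<open>All treated subsets remain covered by the current scheme, so at the end a
      single scheme covers every subset.\<close>
    let ?Inv = "\<lambda>V \<phi>. signaling_scheme I \<phi> \<and> (\<forall>(k, S)\<in>V. covers \<epsilon> S \<phi>)"
    have "spec (foreach (set Ss) (\<lambda>(k, S). extend_prog I L S) \<phi>\<^sub>0)
        (card (set Ss) * (300 * isize ^ 3 + 1)) (?Inv (set Ss))"
    proof (rule spec_foreach[where Inv = ?Inv])
      fix V x \<phi> assume V: "V \<subseteq> set Ss" "x \<in> set Ss - V" and inv: "?Inv V \<phi>"
      obtain k S where x: "x = (k, S)" by force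
      have "S \<subseteq> heavy I \<epsilon>" using V x by (auto simp: Ss(2) small_subsets_def)
      then have "spec (extend_prog I L S \<phi>) (300 * isize ^ 3)
        (\<lambda>\<psi>. signaling_scheme I \<psi> \<and> utility I \<phi> \<le> utility I \<psi> \<and> covers \<epsilon> S \<psi>)"
        using inv by (intro spec_extend[OF \<epsilon> _ L_def]) auto
      then show "spec ((case x of (k, S) \<Rightarrow> extend_prog I L S) \<phi>) (300 * isize ^ 3) (?Inv (insert x V))"
        unfolding x prod.case
        by (rule spec_mono) (use inv covers_mono \<epsilon>(1) in auto)
    qed (use \<phi>\<^sub>0 in auto)
    moreover have "card (set Ss) = ?N"
      unfolding Ss(2) by (intro card_image inj_onI) simp
    moreover have "approx_solution I (1 + \<epsilon>) \<phi>" if "?Inv (set Ss) \<phi>" for \<phi>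
    proof -
      have "opt I \<le> (1 + \<epsilon>) * utility I \<phi>"
        using that by (intro opt_le \<epsilon>) (auto simp: Ss(2))
      then show ?thesis
        using that \<epsilon> by (simp add: approx_solution_def divide_le_eq mult.commute)
    qed
    ultimately show ?thesis
      unfolding foreach_list_distinct[OF Ss(1)] by (auto elim: spec_mono)
  qed
  have "{} \<in> small_subsets \<epsilon> (heavy I \<epsilon>)" using \<epsilon> by (simp add: small_subsets_def)
  then have N: "1 \<le> ?N" using finite_small_subsets[OF finH] by (simp add: Suc_le_eq card_gt_0_iff) blast
  have "spec (algorithm_P I \<epsilon>) (12 * isize ^ 3 + (3 * isize + (12 * isize ^ 2 +
      (6 * isize ^ 2 * ?N + ?N * (300 * isize ^ 3 + 1))))) (approx_solution I (1 + \<epsilon>))"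
    unfolding algorithm_P_def
    apply (rule spec_bind[OF spec_heavy])
    apply (simp only:)
    apply (rule spec_bind[OF light])
    apply (simp only:)
    apply (rule spec_bind[OF spec_arbitrary_scheme])
    apply (rule spec_bind[OF spec_small_subsets[OF H \<epsilon>(1)]])
    apply (rule main; simp)
    done
  moreover have "12 * isize ^ 3 + (3 * isize + (12 * isize ^ 2 +
      (6 * isize ^ 2 * ?N + ?N * (300 * isize ^ 3 + 1)))) \<le> 340 * isize ^ 3 * ?N"
  proof -
    \<comment> \<open>Each summand is now a multiple of \<open>isize ^ 3 * ?N\<close>; the
      coefficients total 334.\<close>
    have "isize ^ 3 \<le> isize ^ 3 * ?N" "isize ^ 2 * ?N \<le> isize ^ 3 * ?N" "?N \<le> isize ^ 3 * ?N"
      using N isize_powers by auto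
    moreover have "6 * isize ^ 2 * ?N + ?N * (300 * isize ^ 3 + 1) =
        6 * (isize ^ 2 * ?N) + 300 * (isize ^ 3 * ?N) + ?N" by (simp add: algebra_simps)
    ultimately show ?thesis using isize_powers by linarith
  qed
  ultimately show ?thesis by (rule spec_time_mono)
qed

end

section \<open>Counting small subsets and the final exponents\<close>

text \<open>Every subset of size at most \<open>k + 1\<close> arises from one of size at most
  \<open>k\<close> by inserting one of the \<open>card H\<close> elements or nothing. The option
  \<open>None\<close> is needed for the empty set and accounts for the \<open>+ 1\<close>.\<close>

lemma card_bounded_subsets:
  assumes "finite H"
  shows "card {S. S \<subseteq> H \<and> card S \<le> k} \<le> (card H + 1) ^ k"
proof (induction k)
  case 0
  have "{S. S \<subseteq> H \<and> card S \<le> 0} = {{}}" using assms finite_subset by fastforce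
  then show ?case by simp
next
  case (Suc k)
  let ?F = "{S. S \<subseteq> H \<and> card S \<le> k}"
  let ?g = "\<lambda>(x, S). case x of None \<Rightarrow> S | Some y \<Rightarrow> insert y S"
  have fin: "finite ?F" using assms by simp
  have "{S. S \<subseteq> H \<and> card S \<le> Suc k} \<subseteq> ?g ` ((insert None (Some ` H)) \<times> ?F)"
  proof
    fix S assume "S \<in> {S. S \<subseteq> H \<and> card S \<le> Suc k}"
    then have S: "S \<subseteq> H" "card S \<le> Suc k" by auto
    have finS: "finite S" using S assms finite_subset by blast
    show "S \<in> ?g ` ((insert None (Some ` H)) \<times> ?F)"
    proof (cases "S = {}")
      case True
      then show ?thesis by (intro image_eqI[where x = "(None, {})"]) auto
    next
      case False
      then obtain y where y: "y \<in> S" by blast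
      then have "S = insert y (S - {y})" "card (S - {y}) \<le> k" using S finS by auto
      then show ?thesis using S y by (intro image_eqI[where x = "(Some y, S - {y})"]) auto
    qed
  qed
  then have "card {S. S \<subseteq> H \<and> card S \<le> Suc k} \<le> card ((insert None (Some ` H)) \<times> ?F)"
    using fin assms by (intro surj_card_le) auto
  also have "\<dots> = (card H + 1) * card ?F"
    using assms by (simp add: card_cartesian_product card_image)
  also have "\<dots> \<le> (card H + 1) * (card H + 1) ^ k" using Suc by (rule mult_le_mono2)
  finally show ?case by simp
qed

context unique_accepts
begin

text \<open>For at least two signals \<open>card H + 1\<close> is at most the square of their
  number, which gives the exponent \<open>2 / \<epsilon>\<close>. With one signal every power is 1
  although there may be two subsets; hence the factor 2.\<close>

lemma card_small_subsets:
  assumes H: "H \<subseteq> signals I" and \<epsilon>: "0 < \<epsilon>"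
  shows "real (card (small_subsets \<epsilon> H)) \<le> 2 * real (card (signals I)) powr (2 / \<epsilon>)"
proof -
  let ?m = "card (signals I)"
  have finH: "finite H" and cardH: "card H \<le> ?m"
    using H finite_signals finite_subset card_mono by blast+
  consider "?m = 1" | "2 \<le> ?m" using card_signals_pos by linarith
  then show ?thesis
  proof cases
    case 1
    have "card (small_subsets \<epsilon> H) \<le> card (Pow H)"
      using finH by (intro card_mono) (auto simp: small_subsets_def)
    also have "\<dots> \<le> 2 ^ 1" unfolding card_Pow[OF finH] using cardH 1 by (intro power_increasing) auto
    finally show ?thesis using 1 by simp
  next
    case 2
    define k where "k = nat \<lfloor>1 / \<epsilon>\<rfloor>"
    have k: "real k \<le> 1 / \<epsilon>" using \<epsilon> by (simp add: k_def)
    have "small_subsets \<epsilon> H = {S. S \<subseteq> H \<and> card S \<le> k}"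
      using \<epsilon> by (auto simp: small_subsets_def k_def le_nat_floor le_nat_iff le_floor_iff)
    then have "card (small_subsets \<epsilon> H) \<le> (card H + 1) ^ k"
      using card_bounded_subsets[OF finH, of k] by simp
    also have "\<dots> \<le> (?m ^ 2) ^ k"
    proof (rule power_mono)
      have "card H + 1 \<le> 2 * ?m" using cardH 2 by linarith
      also have "\<dots> \<le> ?m * ?m" using 2 by (rule mult_le_mono1)
      finally show "card H + 1 \<le> ?m ^ 2" by (simp add: power2_eq_square)
    qed simp
    finally have "real (card (small_subsets \<epsilon> H)) \<le> real ((?m ^ 2) ^ k)" by (simp only: of_nat_le_iff)
    also have "\<dots> = real ?m powr (2 * real k)"
      using 2 by (simp add: powr_realpow[symmetric] flip: power_mult)
    also have "\<dots> \<le> real ?m powr (2 / \<epsilon>)" using 2 k by (intro powr_mono) auto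
    finally show ?thesis using powr_ge_zero[of "real ?m" "2 / \<epsilon>"] by linarith
  qed
qed

text \<open>The exponent 5 combines 3 from \<open>isize ^ 3\<close>, enlarged to
  \<open>3 / \<epsilon>\<close> by \<open>\<epsilon> \<le> 1\<close>, with 2 from the subsets, and
  680 is twice 340. The power of the number of states is raised from 3 to 5 because one constant
  serves both exponents.\<close>

lemma time_bound:
  assumes \<epsilon>: "0 < \<epsilon>" "\<epsilon> \<le> 1" and H: "H \<subseteq> signals I"
  shows "real (340 * isize ^ 3 * card (small_subsets \<epsilon> H))
    \<le> 680 * real (card (signals I)) powr (5 / \<epsilon>) * real (card (states I)) powr 5"
proof -
  let ?m = "real (card (signals I))" and ?n = "real (card (states I))"
  have m: "1 \<le> ?m" and n: "1 \<le> ?n" using card_signals_pos card_states_pos by simp_all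
  have "?m ^ 3 = ?m powr 3" using m by simp
  also have "\<dots> \<le> ?m powr (3 / \<epsilon>)" using m \<epsilon> by (intro powr_mono) (auto simp: field_simps)
  finally have m3: "?m ^ 3 \<le> ?m powr (3 / \<epsilon>)" .
  have "?n ^ 3 = ?n powr 3" using n by simp
  also have "\<dots> \<le> ?n powr 5" using n by (intro powr_mono) auto
  finally have n3: "?n ^ 3 \<le> ?n powr 5" .
  have "real (340 * isize ^ 3 * card (small_subsets \<epsilon> H)) =
      340 * (?n ^ 3 * (?m ^ 3 * real (card (small_subsets \<epsilon> H))))"
    by (simp add: isize_def power_mult_distrib)
  also have "\<dots> \<le> 340 * (?n powr 5 * (?m powr (3 / \<epsilon>) * (2 * ?m powr (2 / \<epsilon>))))"
    using n3 m3 card_small_subsets[OF H \<epsilon>(1)] by (intro mult_left_mono mult_mono) auto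
  also have "\<dots> = 680 * (?m powr (3 / \<epsilon>) * ?m powr (2 / \<epsilon>)) * ?n powr 5" by simp
  also have "?m powr (3 / \<epsilon>) * ?m powr (2 / \<epsilon>) = ?m powr (5 / \<epsilon>)"
    unfolding powr_add[symmetric] by (simp add: add_divide_distrib[symmetric])
  finally show ?thesis .
qed

end

theorem theorem5p9:
  "\<exists>C c :: real. \<forall>(I :: ('s, 'g) persuasion) \<epsilon> :: real.
     persuasion_instance I \<and> card (acceptable I) = 1 \<and> 0 < \<epsilon> \<and> \<epsilon> \<le> 1 \<longrightarrow>
     (\<exists>t :: nat.
        real t \<le> C * real (card (signals I)) powr (c / \<epsilon>) * real (card (states I)) powr c \<and>
        runs_within (algorithm_P I \<epsilon>) t (approx_solution I (1 + \<epsilon>)))"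
proof (rule exI[where x = 680], rule exI[where x = 5], intro allI impI, elim conjE)
  fix I :: "('s, 'g) persuasion" and \<epsilon> :: real
  assume I: "persuasion_instance I" "card (acceptable I) = 1" and \<epsilon>: "0 < \<epsilon>" "\<epsilon> \<le> 1"
  interpret unique_accepts I using I by unfold_locales
  have "heavy I \<epsilon> \<subseteq> signals I" by (auto simp: heavy_def)
  then show "\<exists>t. real t \<le> 680 * real (card (signals I)) powr (5 / \<epsilon>) * real (card (states I)) powr 5 \<and>
      runs_within (algorithm_P I \<epsilon>) t (approx_solution I (1 + \<epsilon>))"
    using time_bound[OF \<epsilon>] spec_runs_within[OF spec_algorithm[OF \<epsilon>]] by blast
qed

end
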